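(* Assume that, for all $i,j\in\{1,\dots,k\}$, as $n\to\infty$: $n_n^{(i)}/n_n^{(j)}\to\nu_{ij}\in(0,\infty)$; $1/n_n^{(i)}\ll p_n^{(i)}\ll (n_n^{(i)})^{-1/r}$; $q_n^{(ij)}\le\min\{p_n^{(i)},p_n^{(j)}\}$ for all $n$; $q_n^{(ij)}/p_n^{(i)}\to\gamma_{ij}\in[0,1]$ and $p_n^{(i)}/p_n^{(j)}\to\mu_{ij}\in(0,\infty)$; $a_n^{(i)}/g_n^{(i)}\to\alpha_i\ge 0$; the matrix $\chi=(\chi_{ij})_{1\le i,j\le k}$ is irreducible; and $\alpha_1\ge\alpha_2\ge\dots\ge\alpha_k$ with $\alpha_1>0$. Assume moreover the super-critical condition $$\min_{x\in\mathcal D_\rho}\rho_1(x)>0$$ (with the convention $\min\emptyset=+\infty$). Then for every $\varepsilon>0$ there exists $c(\varepsilon)\in(0,\infty)$ such that, as $n\to\infty$, $$P\left(\left|\frac{A_n^*}{n}-1\right|>\varepsilon\right)=O\left(e^{-c(\varepsilon)g_n^{(1)}}\right).$$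
   Context: Fix integers $r\ge2$ and $k\ge1$. All limits are as $n\to\infty$; $f_1\ll f_2$ means $f_1(n)/f_2(n)\to0$. Stochastic block model: for each $n$, a random graph on $n$ nodes partitioned into communities $G_1,\dots,G_k$ of sizes $n_n^{(1)},\dots,n_n^{(k)}\in\{1,2,\dots\}$, $\sum_i n_n^{(i)}=n$. Each pair of distinct nodes, one in $G_i$ and the other in $G_j$ (possibly $i=j$), is joined by an edge independently of the other pairs with probability $q_n^{(ij)}=q_n^{(ji)}\in[0,1)$. Put $p_n^{(i)}:=q_n^{(ii)}$. Bootstrap percolation: in each $G_i$, a set of $a_n^{(i)}$ nodes ($0\le a_n^{(i)}\le n_n^{(i)}$), called seeds, is chosen uniformly at random and declared active; all other nodes are initially inactive. An inactive node becomes active as soon as at least $r$ of its neighbours are active; active nodes stay active forever. The process stops when no more nodes can be activated. $A_n^*$ is the final number of active nodes (seeds included). Definitions: $g_n^{(i)}:=\left(1-\frac1r\right)\left(\frac{(r-1)!}{n_n^{(i)}(p_n^{(i)})^r}\right)^{1/(r-1)}$; $\chi_{ij}:=\lim_{n\to\infty}\frac{q_n^{(ij)}g_n^{(j)}}{p_n^{(i)}g_n^{(i)}}=\gamma_{ij}(\nu_{ij}(\mu_{ij})^r)^{1/(r-1)}$ (so $\chi_{ii}=1$). For $x\in[0,\infty)^k$ and $1\le i\le k$, $$\rho_i(x):=\alpha_i-x_i+r^{-1}(1-r^{-1})^{r-1}\Bigl(\sum_{j=1}^k\chi_{ij}x_j\Bigr)^r.$$ $\mathcal D:=\{x\in[0,r/(r-1)]^k: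 x_i+\sum_{j\ne i}\chi_{ij}x_j\le r/(r-1)\ \forall i\}$ and $\mathcal D_\rho:=\{x\in\mathcal D:\rho_1(x)=\dots=\rho_k(x)\}$. *)

theory Defs
  imports "HOL-Probability.Probability" "HOL-Library.Landau_Symbols"
begin

text \<open>
  The nodes of the graph with index \<open>n\<close> are \<open>0, \<dots>, n - 1\<close>, and the partition into communities
  is given by a labelling \<open>c n\<close> of the nodes with labels in \<open>{1..k}\<close>. Communities are indexed by
  \<open>{1..k}\<close> throughout; values of the parameters at other indices are irrelevant.
\<close>

definition community :: "(nat \<Rightarrow> nat \<Rightarrow> nat) \<Rightarrow> nat \<Rightarrow> nat \<Rightarrow> nat set" where
  "community c n i = {v. v < n \<and> c n v = i}"

definition comm_size :: "(nat \<Rightarrow> nat \<Rightarrow> nat) \<Rightarrow> nat \<Rightarrow> nat \<Rightarrow> nat" where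
  "comm_size c n i = card (community c n i)"

text \<open>
  A graph is represented by its symmetric, irreflexive adjacency relation. One independent
  Bernoulli variable is used per unordered pair of distinct nodes, indexed by \<open>(u, v)\<close> with
  \<open>u < v\<close>; the default value \<open>False\<close> of \<open>X\<close> outside these indices excludes loops.
\<close>

definition sbm_graph ::
    "(nat \<Rightarrow> nat \<Rightarrow> nat) \<Rightarrow> (nat \<Rightarrow> nat \<Rightarrow> nat \<Rightarrow> real) \<Rightarrow> nat \<Rightarrow> (nat \<times> nat) set pmf" where
  "sbm_graph c q n =
     map_pmf (\<lambda>X. {(u, v). X (min u v, max u v)})
       (Pi_pmf {(u, v). u < v \<and> v < n} False (\<lambda>(u, v). bernoulli_pmf (q n (c n u) (c n v))))"

text \<open>
  The seed sets of the different communities are chosen independently of each other.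
\<close>

definition seeds ::
    "nat \<Rightarrow> (nat \<Rightarrow> nat \<Rightarrow> nat) \<Rightarrow> (nat \<Rightarrow> nat \<Rightarrow> nat) \<Rightarrow> nat \<Rightarrow> nat set pmf" where
  "seeds k c a n =
     map_pmf (\<lambda>S. \<Union>i\<in>{1..k}. S i)
       (Pi_pmf {1..k} {} (\<lambda>i. pmf_of_set {T. T \<subseteq> community c n i \<and> card T = a n i}))"

definition bootstrap_step :: "nat \<Rightarrow> (nat \<times> nat) set \<Rightarrow> nat set \<Rightarrow> nat set" where
  "bootstrap_step r E A = A \<union> {v. r \<le> card {u \<in> A. (u, v) \<in> E}}"

definition bootstrap_final :: "nat \<Rightarrow> (nat \<times> nat) set \<Rightarrow> nat set \<Rightarrow> nat set" where
  "bootstrap_final r E S = (\<Union>t. (bootstrap_step r E ^^ t) S)"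

text \<open>
  The graph and the seeds are independent.
\<close>

definition final_active ::
    "nat \<Rightarrow> nat \<Rightarrow> (nat \<Rightarrow> nat \<Rightarrow> nat) \<Rightarrow> (nat \<Rightarrow> nat \<Rightarrow> nat \<Rightarrow> real) \<Rightarrow> (nat \<Rightarrow> nat \<Rightarrow> nat) \<Rightarrow>
     nat \<Rightarrow> nat pmf" where
  "final_active r k c q a n =
     map_pmf (\<lambda>(E, S). card (bootstrap_final r E S)) (pair_pmf (sbm_graph c q n) (seeds k c a n))"

definition crit_size ::
    "nat \<Rightarrow> (nat \<Rightarrow> nat \<Rightarrow> nat) \<Rightarrow> (nat \<Rightarrow> nat \<Rightarrow> nat \<Rightarrow> real) \<Rightarrow> nat \<Rightarrow> nat \<Rightarrow> real" where
  "crit_size r c q n i =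
     (1 - 1 / real r) *
     (fact (r - 1) / (real (comm_size c n i) * q n i i ^ r)) powr (1 / (real r - 1))"

definition chi ::
    "nat \<Rightarrow> (nat \<Rightarrow> nat \<Rightarrow> nat) \<Rightarrow> (nat \<Rightarrow> nat \<Rightarrow> nat \<Rightarrow> real) \<Rightarrow> nat \<Rightarrow> nat \<Rightarrow> real" where
  "chi r c q i j = lim (\<lambda>n. (q n i j * crit_size r c q n j) / (q n i i * crit_size r c q n i))"

text \<open>
  A square matrix is irreducible if no simultaneous permutation of its rows and columns brings it
  to block triangular form with two nonempty diagonal blocks; \<open>S\<close> is the set of indices of the
  block whose row has a zero off-diagonal block.
\<close>

definition irreducible_matrix :: "nat \<Rightarrow> (nat \<Rightarrow> nat \<Rightarrow> real) \<Rightarrow> bool" where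
  "irreducible_matrix k M \<longleftrightarrow>
     \<not> (\<exists>S. S \<noteq> {} \<and> S \<subset> {1..k} \<and> (\<forall>i\<in>S. \<forall>j\<in>{1..k} - S. M i j = 0))"

definition rho ::
    "nat \<Rightarrow> nat \<Rightarrow> (nat \<Rightarrow> nat \<Rightarrow> real) \<Rightarrow> (nat \<Rightarrow> real) \<Rightarrow> nat \<Rightarrow> (nat \<Rightarrow> real) \<Rightarrow> real" where
  "rho r k M \<alpha> i x =
     \<alpha> i - x i + (1 / real r) * (1 - 1 / real r) ^ (r - 1) * (\<Sum>j\<in>{1..k}. M i j * x j) ^ r"

definition region_D :: "nat \<Rightarrow> nat \<Rightarrow> (nat \<Rightarrow> nat \<Rightarrow> real) \<Rightarrow> (nat \<Rightarrow> real) set" where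
  "region_D r k M =
     {x \<in> {1..k} \<rightarrow>\<^sub>E {0..real r / (real r - 1)}.
        \<forall>i\<in>{1..k}. x i + (\<Sum>j\<in>{1..k} - {i}. M i j * x j) \<le> real r / (real r - 1)}"

definition region_D_rho ::
    "nat \<Rightarrow> nat \<Rightarrow> (nat \<Rightarrow> nat \<Rightarrow> real) \<Rightarrow> (nat \<Rightarrow> real) \<Rightarrow> (nat \<Rightarrow> real) set" where
  "region_D_rho r k M \<alpha> =
     {x \<in> region_D r k M. \<forall>i\<in>{1..k}. rho r k M \<alpha> i x = rho r k M \<alpha> 1 x}"

text \<open>
  The minimum of \<open>rho 1\<close> over \<open>region_D_rho\<close>. That set is compact (up to the coordinates outside
  \<open>{1..k}\<close>, which are fixed) and \<open>rho 1\<close> is continuous, so the infimum is attained if the set is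
  nonempty; in the extended reals the infimum over the empty set is \<open>\<infinity>\<close>.
\<close>

definition min_rho :: "nat \<Rightarrow> nat \<Rightarrow> (nat \<Rightarrow> nat \<Rightarrow> real) \<Rightarrow> (nat \<Rightarrow> real) \<Rightarrow> ereal" where
  "min_rho r k M \<alpha> = (INF x \<in> region_D_rho r k M \<alpha>. ereal (rho r k M \<alpha> 1 x))"

end

theory Submission
  imports Defs
begin

text \<open>
  For a set \<open>F\<close> of nodes containing the seeds, the final set is \<open>F\<close> iff the seeds activate all of \<open>F\<close> inside
  the subgraph induced on \<open>F\<close> and every node outside \<open>F\<close> has fewer than \<open>r\<close> neighbours in \<open>F\<close>. These
  events depend on disjoint sets of edges, so the probability is a product whose first factor is
  intractable. That factor is unchanged if in one community the non-seeds are thinned with retention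
  probability \<open>\<theta>\<close>, whereas the other factors change explicitly; since the probabilities in the thinned
  model add up to at most 1, the final set lies in a family \<open>\<F>\<close> with probability at most the largest
  quotient of the explicit factors over \<open>\<F>\<close>. This has the precision of a Chernoff bound and costs no
  union bound over the exponentially many sets \<open>F\<close>.

  A set \<open>F\<close> with at most \<open>(1 - \<epsilon>) n\<close> nodes always has a community in which this quotient is exponentially
  small: one in which \<open>F\<close> holds less than \<open>1 - \<epsilon>\<close> of the nodes and which is linked to a community where
  \<open>F\<close> holds a positive fraction; or one in which \<open>F\<close> is small compared with the community but large
  compared with the critical size; or else \<open>F\<close> has the order of the critical size everywhere. In the last
  case, rescaling gives a point \<open>x\<close> of a compact set at which some \<open>rho i\<close> is bounded away from 0,
  because the supercritical condition excludes nonnegative points with \<open>rho \<le> 0\<close> in every coordinate.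
\<close>

section \<open>Final active sets\<close>

text \<open>Finiteness of \<open>E\<close> matters because \<open>card\<close> is 0 on infinite
  sets, where the neighbour count would not be monotone.\<close>

lemma bootstrap_step_mono:
  assumes "finite E" "E' \<subseteq> E" "A \<subseteq> B"
  shows "bootstrap_step r E' A \<subseteq> bootstrap_step r E B"
proof -
  have "card {u \<in> A. (u, v) \<in> E'} \<le> card {u \<in> B. (u, v) \<in> E}" for v
  proof (rule card_mono)
    show "finite {u \<in> B. (u, v) \<in> E}"
      by (rule finite_subset[of _ "fst ` E"]) (use assms(1) in force)+
  qed (use assms in blast)
  then show ?thesis
    using assms(3) order_trans unfolding bootstrap_step_def by blast
qed

lemma bootstrap_step_iter_mono: "t \<le> t' \<Longrightarrow> (bootstrap_step r E ^^ t) S \<subseteq> (bootstrap_step r E ^^ t') S"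
  by (rule lift_Suc_mono_le[of "\<lambda>t. (bootstrap_step r E ^^ t) S"]) (auto simp: bootstrap_step_def)

lemma bootstrap_final_least:
  assumes "finite E" "S \<subseteq> B" "bootstrap_step r E B \<subseteq> B"
  shows "bootstrap_final r E S \<subseteq> B"
proof -
  have "(bootstrap_step r E ^^ t) S \<subseteq> B" for t
  proof (induction t)
    case (Suc t)
    then show ?case
      using bootstrap_step_mono[OF assms(1) subset_refl Suc] assms(3) by auto
  qed (use assms in auto)
  then show ?thesis by (auto simp: bootstrap_final_def)
qed

lemma seeds_subset_bootstrap_final: "S \<subseteq> bootstrap_final r E S"
  by (auto simp: bootstrap_final_def intro!: exI[of _ 0])

lemma bootstrap_final_closed:
  assumes "finite E"
  shows "bootstrap_step r E (bootstrap_final r E S) \<subseteq> bootstrap_final r E S"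
proof
  fix v assume v: "v \<in> bootstrap_step r E (bootstrap_final r E S)"
  let ?A = "\<lambda>t. (bootstrap_step r E ^^ t) S"
  let ?N = "{u \<in> bootstrap_final r E S. (u, v) \<in> E}"
  show "v \<in> bootstrap_final r E S"
  proof (cases "v \<in> bootstrap_final r E S")
    case False
    then have r: "r \<le> card ?N" using v by (auto simp: bootstrap_step_def)
    have "finite ?N"
      by (rule finite_subset[of _ "fst ` E"]) (use assms in force)+
    moreover have "\<forall>u\<in>?N. \<exists>t. u \<in> ?A t" by (auto simp: bootstrap_final_def)
    then obtain \<tau> where \<tau>: "\<And>u. u \<in> ?N \<Longrightarrow> u \<in> ?A (\<tau> u)" by metis
    \<comment> \<open>A common time by which all of the finitely many neighbours in
      \<open>?N\<close> are active; a sum, unlike a maximum, also makes sense when \<open>?N\<close>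
      is empty.\<close>
    ultimately have "?N \<subseteq> ?A (\<Sum>u\<in>?N. \<tau> u)"
      by (smt (verit, best) bootstrap_step_iter_mono member_le_sum subset_iff zero_le)
    then have "?N = {u \<in> ?A (\<Sum>u\<in>?N. \<tau> u). (u, v) \<in> E}"
      by (auto simp: bootstrap_final_def)
    then have "v \<in> ?A (Suc (\<Sum>u\<in>?N. \<tau> u))"
      using r by (simp add: bootstrap_step_def)
    then show ?thesis unfolding bootstrap_final_def by blast
  qed
qed

lemma bootstrap_final_subset:
  assumes "finite E" "E \<subseteq> W \<times> W" "S \<subseteq> W" "r \<ge> 1"
  shows "bootstrap_final r E S \<subseteq> W"
proof (rule bootstrap_final_least)
  have "card {u \<in> W. (u, v) \<in> E} = 0" if "v \<notin> W" for v
    using that assms(2) by (auto simp: card_eq_0_iff)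
  then show "bootstrap_step r E W \<subseteq> W"
    using assms(4) by (force simp: bootstrap_step_def)
qed (use assms in auto)

text \<open>If the final set is \<open>F\<close>, every intermediate set lies in \<open>F\<close>,
  so the process only uses edges inside \<open>F\<close>. On the right the first conjunct depends
  only on edges inside \<open>F\<close> and the second only on edges between \<open>F\<close> and
  \<open>W - F\<close>.\<close>

lemma bootstrap_final_eq_iff:
  assumes E: "finite E" and r: "r \<ge> 1" and SF: "S \<subseteq> F" and FW: "F \<subseteq> W"
  shows "bootstrap_final r (E \<inter> W \<times> W) S = F \<longleftrightarrow>
    bootstrap_final r (E \<inter> F \<times> F) S = F \<and> (\<forall>v\<in>W - F. card {u \<in> F. (u, v) \<in> E} < r)"
proof -
  let ?W = "E \<inter> W \<times> W" and ?F = "E \<inter> F \<times> F"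
  have fin: "finite ?W" "finite ?F" using E by auto
  show ?thesis
  proof
    assume F: "bootstrap_final r ?W S = F"
    then have closed: "bootstrap_step r ?W F \<subseteq> F" using bootstrap_final_closed[OF fin(1)] by metis
    have "card {u \<in> F. (u, v) \<in> E} < r" if "v \<in> W - F" for v
    proof -
      have "{u \<in> F. (u, v) \<in> ?W} = {u \<in> F. (u, v) \<in> E}" using FW that by auto
      moreover have "v \<notin> bootstrap_step r ?W F" using closed that by auto
      ultimately show ?thesis by (simp add: bootstrap_step_def)
    qed
    moreover have "bootstrap_final r ?F S \<subseteq> F"
      using bootstrap_final_subset[OF fin(2) _ SF r] by blast
    moreover have "(bootstrap_step r ?W ^^ t) S \<subseteq> bootstrap_final r ?F S" for t
    proof (induction t)
      case 0
      show ?case using seeds_subset_bootstrap_final by auto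
    next
      case (Suc t)
      let ?A = "(bootstrap_step r ?W ^^ t) S"
      have sub: "(bootstrap_step r ?W ^^ t) S \<subseteq> F" for t using F by (auto simp: bootstrap_final_def)
      have "(bootstrap_step r ?W ^^ Suc t) S \<subseteq> bootstrap_step r ?F ?A"
      proof
        fix v assume v: "v \<in> (bootstrap_step r ?W ^^ Suc t) S"
        then have "v \<in> F" using sub by blast
        then have "{u \<in> ?A. (u, v) \<in> ?W} = {u \<in> ?A. (u, v) \<in> ?F}" using sub[of t] FW by auto
        then show "v \<in> bootstrap_step r ?F ?A" using v by (simp add: bootstrap_step_def)
      qed
      also have "\<dots> \<subseteq> bootstrap_step r ?F (bootstrap_final r ?F S)"
        by (rule bootstrap_step_mono[OF fin(2) _ Suc]) simp
      also have "\<dots> \<subseteq> bootstrap_final r ?F S" by (rule bootstrap_final_closed[OF fin(2)])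
      finally show ?case .
    qed
    then have "F \<subseteq> bootstrap_final r ?F S" using F unfolding bootstrap_final_def by blast
    ultimately show "bootstrap_final r ?F S = F \<and> (\<forall>v\<in>W - F. card {u \<in> F. (u, v) \<in> E} < r)"
      by blast
  next
    assume "bootstrap_final r ?F S = F \<and> (\<forall>v\<in>W - F. card {u \<in> F. (u, v) \<in> E} < r)"
    then have F: "bootstrap_final r ?F S = F" and *: "\<And>v. v \<in> W - F \<Longrightarrow> card {u \<in> F. (u, v) \<in> E} < r"
      by auto
    have "bootstrap_step r ?W F \<subseteq> F"
    proof
      fix v assume v: "v \<in> bootstrap_step r ?W F"
      show "v \<in> F"
      proof (rule ccontr)
        assume nF: "v \<notin> F"
        then have c: "r \<le> card {u \<in> F. (u, v) \<in> ?W}" using v by (simp add: bootstrap_step_def)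
        \<comment> \<open>A node outside \<open>W\<close> has no neighbours in the restricted graph,
          so \<open>r \<ge> 1\<close> keeps it inactive.\<close>
        then have "{u \<in> F. (u, v) \<in> ?W} \<noteq> {}" using r by (metis card.empty not_one_le_zero order_trans)
        then have "v \<in> W" by auto
        moreover have "{u \<in> F. (u, v) \<in> ?W} = {u \<in> F. (u, v) \<in> E}" using \<open>v \<in> W\<close> FW by auto
        ultimately show False using *[of v] c nF by auto
      qed
    qed
    then have "bootstrap_final r ?W S \<subseteq> F" by (rule bootstrap_final_least[OF fin(1) SF])
    moreover have "bootstrap_step r ?F (bootstrap_final r ?W S) \<subseteq> bootstrap_step r ?W (bootstrap_final r ?W S)"
      by (rule bootstrap_step_mono[OF fin(1)]) (use FW in auto)
    then have "bootstrap_step r ?F (bootstrap_final r ?W S) \<subseteq> bootstrap_final r ?W S"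
      using bootstrap_final_closed[OF fin(1), of r S] by blast
    then have "F \<subseteq> bootstrap_final r ?W S"
      using bootstrap_final_least[OF fin(2) seeds_subset_bootstrap_final] F by metis
    ultimately show "bootstrap_final r ?W S = F" by blast
  qed
qed

section \<open>Independent Bernoulli variables\<close>

text \<open>The last two assumptions say that \<open>P\<close> and \<open>Q\<close> depend only on
  the coordinates in \<open>J1\<close> and \<open>J2\<close>. Splitting the product measure along
  \<open>J1\<close> and \<open>I - J1\<close> turns the joint event into a rectangle.\<close>

lemma Pi_pmf_prob_conj:
  assumes I: "finite I" and J: "J1 \<inter> J2 = {}" "J1 \<subseteq> I" "J2 \<subseteq> I"
    and P: "\<And>X Y. (\<And>i. i \<in> J1 \<Longrightarrow> X i = Y i) \<Longrightarrow> P X \<longleftrightarrow> P Y"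
    and Q: "\<And>X Y. (\<And>i. i \<in> J2 \<Longrightarrow> X i = Y i) \<Longrightarrow> Q X \<longleftrightarrow> Q Y"
  shows "measure_pmf.prob (Pi_pmf I d p) {X. P X \<and> Q X} =
    measure_pmf.prob (Pi_pmf I d p) {X. P X} * measure_pmf.prob (Pi_pmf I d p) {X. Q X}"
proof -
  let ?h = "\<lambda>(f, g) x. if x \<in> J1 then f x else g x"
  let ?p = "pair_pmf (Pi_pmf J1 d p) (Pi_pmf (I - J1) d p)"
  have eq: "Pi_pmf I d p = map_pmf ?h ?p"
    using Pi_pmf_union[of J1 "I - J1" d p] I J(2)
    by (simp add: Un_absorb1 finite_subset)
  have 1: "P (?h (f, g)) \<longleftrightarrow> P f" for f g by (rule P) auto
  have 2: "Q (?h (f, g)) \<longleftrightarrow> Q g" for f g by (rule Q) (use J in auto)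
  have *: "measure_pmf.prob (Pi_pmf I d p) {X. R X} = measure_pmf.prob ?p (?h -` {X. R X})" for R
    unfolding eq by simp
  have "?h -` {X. P X \<and> Q X} = {f. P f} \<times> {g. Q g}" "?h -` {X. P X} = {f. P f} \<times> UNIV"
    "?h -` {X. Q X} = UNIV \<times> {g. Q g}"
    using 1 2 by auto
  moreover have "measure_pmf.prob (pair_pmf M N) (A \<times> B) = measure_pmf.prob M A * measure_pmf.prob N B"
    for M :: "('a \<Rightarrow> 'b) pmf" and N :: "('a \<Rightarrow> 'b) pmf" and A B
  proof -
    \<comment> \<open>Both sets are cut down to the supports because the product rule is applied to
      countable sets.\<close>
    have "measure_pmf.prob (pair_pmf M N) (A \<times> B) =
      measure_pmf.prob (pair_pmf M N) ((A \<inter> set_pmf M) \<times> (B \<inter> set_pmf N))"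
      by (rule measure_prob_cong_0) (auto simp: pmf_eq_0_set_pmf)
    also have "\<dots> = measure_pmf.prob M (A \<inter> set_pmf M) * measure_pmf.prob N (B \<inter> set_pmf N)"
      by (rule measure_pmf_prob_product) (auto intro: countable_Int2)
    finally show ?thesis by (simp add: measure_Int_set_pmf)
  qed
  ultimately show ?thesis unfolding * by simp
qed

lemma Pi_pmf_prob_conj_all:
  assumes I: "finite I" and R: "finite R" and dis: "disjoint_family_on J R" "\<And>v. v \<in> R \<Longrightarrow> K \<inter> J v = {}"
    and sub: "K \<subseteq> I" "\<And>v. v \<in> R \<Longrightarrow> J v \<subseteq> I"
    and P: "\<And>X Y. (\<And>i. i \<in> K \<Longrightarrow> X i = Y i) \<Longrightarrow> P X \<longleftrightarrow> P Y"
    and Q: "\<And>v X Y. v \<in> R \<Longrightarrow> (\<And>i. i \<in> J v \<Longrightarrow> X i = Y i) \<Longrightarrow> Q v X \<longleftrightarrow> Q v Y"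
  shows "measure_pmf.prob (Pi_pmf I d p) {X. P X \<and> (\<forall>v\<in>R. Q v X)} =
    measure_pmf.prob (Pi_pmf I d p) {X. P X} * (\<Prod>v\<in>R. measure_pmf.prob (Pi_pmf I d p) {X. Q v X})"
  using R dis sub(2) Q
proof (induction R rule: finite_induct)
  case (insert w R)
  have "measure_pmf.prob (Pi_pmf I d p) {X. P X \<and> (\<forall>v\<in>insert w R. Q v X)} =
    measure_pmf.prob (Pi_pmf I d p) {X. Q w X \<and> (P X \<and> (\<forall>v\<in>R. Q v X))}"
    by (rule arg_cong[where f = "measure_pmf.prob _"]) auto
  also have "\<dots> = measure_pmf.prob (Pi_pmf I d p) {X. Q w X} *
      measure_pmf.prob (Pi_pmf I d p) {X. P X \<and> (\<forall>v\<in>R. Q v X)}"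
  proof (rule Pi_pmf_prob_conj[OF I, of "J w" "K \<union> (\<Union>v\<in>R. J v)"])
    show "J w \<inter> (K \<union> \<Union> (J ` R)) = {}"
      using insert.prems(1,2) insert.hyps(2) by (auto simp: disjoint_family_on_def)
    show "K \<union> \<Union> (J ` R) \<subseteq> I" using sub(1) insert.prems(3) by blast
    show "Q w X \<longleftrightarrow> Q w Y" if "\<And>i. i \<in> J w \<Longrightarrow> X i = Y i" for X Y
      using insert.prems(4)[of w X Y] that by simp
    show "(P X \<and> (\<forall>v\<in>R. Q v X)) \<longleftrightarrow> (P Y \<and> (\<forall>v\<in>R. Q v Y))"
      if "\<And>i. i \<in> K \<union> \<Union> (J ` R) \<Longrightarrow> X i = Y i" for X Y
    proof -
      have "P X \<longleftrightarrow> P Y" by (rule P) (use that in auto)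
      moreover have "Q v X \<longleftrightarrow> Q v Y" if "v \<in> R" for v
        by (rule insert.prems(4)) (use that \<open>\<And>i. i \<in> K \<union> \<Union> (J ` R) \<Longrightarrow> X i = Y i\<close> in auto)
      ultimately show ?thesis by auto
    qed
  qed (use insert.prems(3) in auto)
  also have "measure_pmf.prob (Pi_pmf I d p) {X. P X \<and> (\<forall>v\<in>R. Q v X)} =
      measure_pmf.prob (Pi_pmf I d p) {X. P X} * (\<Prod>v\<in>R. measure_pmf.prob (Pi_pmf I d p) {X. Q v X})"
  proof (rule insert.IH)
    show "disjoint_family_on J R" using insert.prems(1) by (auto simp: disjoint_family_on_def)
    show "Q v X \<longleftrightarrow> Q v Y" if "v \<in> R" "\<And>i. i \<in> J v \<Longrightarrow> X i = Y i" for v X Y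
      by (rule insert.prems(4)) (use that in auto)
  qed (use insert.prems(2,3) in simp_all)
  finally show ?case using insert.hyps by (simp add: mult_ac)
qed simp

text \<open>Conditioning on the variable at \<open>e\<close>, which is independent of the count over
  \<open>F\<close>. Both tail bounds below follow from this recursion by induction on
  \<open>F\<close> with \<open>r\<close> arbitrary.\<close>

lemma bernoulli_count_recursion:
  fixes w :: "'a \<Rightarrow> real" and I :: "'a set"
  defines "M \<equiv> Pi_pmf I False (\<lambda>i. bernoulli_pmf (w i))"
  assumes I: "finite I" and e: "e \<in> I" "0 \<le> w e" "w e \<le> 1" and F: "F \<subseteq> I" "e \<notin> F"
  shows "measure_pmf.prob M {X. card {i \<in> insert e F. X i} < Suc r} =
    (1 - w e) * measure_pmf.prob M {X. card {i \<in> F. X i} < Suc r} +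
    w e * measure_pmf.prob M {X. card {i \<in> F. X i} < r}"
proof -
  have finF: "finite F" using F I finite_subset by blast
  have one: "measure_pmf.prob M {X. X e = b} = pmf (bernoulli_pmf (w e)) b" for b
  proof -
    have "pmf (map_pmf (\<lambda>X. X e) M) b = pmf (bernoulli_pmf (w e)) b"
      unfolding M_def using Pi_pmf_component[OF I, of e False "\<lambda>i. bernoulli_pmf (w i)"] e(1) by simp
    moreover have "pmf (map_pmf (\<lambda>X. X e) M) b = measure_pmf.prob M {X. X e = b}"
      by (simp add: pmf_map vimage_def)
    ultimately show ?thesis by simp
  qed
  have ins: "card {i \<in> insert e F. X i} = (if X e then Suc (card {i \<in> F. X i}) else card {i \<in> F. X i})" for X
  proof -
    have "{i \<in> insert e F. X i} = (if X e then insert e {i \<in> F. X i} else {i \<in> F. X i})"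
      using F by auto
    then show ?thesis using F finF by auto
  qed
  have cong: "card {i \<in> F. X i} = card {i \<in> F. Y i}" if "\<And>i. i \<in> F \<Longrightarrow> X i = Y i" for X Y :: "'a \<Rightarrow> bool"
    by (rule arg_cong[where f = card]) (use that in auto)
  have "{X. card {i \<in> insert e F. X i} < Suc r} =
     {X. X e = False \<and> card {i \<in> F. X i} < Suc r} \<union> {X. X e = True \<and> card {i \<in> F. X i} < r}"
    using ins by auto
  then have "measure_pmf.prob M {X. card {i \<in> insert e F. X i} < Suc r} =
     measure_pmf.prob M {X. X e = False \<and> card {i \<in> F. X i} < Suc r} +
     measure_pmf.prob M {X. X e = True \<and> card {i \<in> F. X i} < r}"
    by (simp only:) (rule measure_pmf.finite_measure_Union, auto)
  moreover have "measure_pmf.prob M {X. X e = b \<and> card {i \<in> F. X i} < s} =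
      measure_pmf.prob M {X. X e = b} * measure_pmf.prob M {X. card {i \<in> F. X i} < s}" for b s
    unfolding M_def
  proof (rule Pi_pmf_prob_conj[OF I, of "{e}" F])
    show "card {i \<in> F. X i} < s \<longleftrightarrow> card {i \<in> F. Y i} < s" if "\<And>i. i \<in> F \<Longrightarrow> X i = Y i" for X Y
      using cong[of X Y] that by simp
  qed (use e F in auto)
  ultimately show ?thesis using e by (simp only: one) simp
qed

text \<open>This is Markov's inequality for 2 to the power of minus the count, whose expectation is
  the product of the factors \<open>1 - w i / 2\<close>. The induction reproduces it through
  \<open>(1 - w e) * 2 ^ Suc r' + w e * 2 ^ r' = 2 ^ Suc r' * (1 - w e / 2)\<close>.\<close>

lemma bernoulli_count_less_le_exp:
  fixes w :: "'a \<Rightarrow> real" and I :: "'a set"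
  defines "M \<equiv> Pi_pmf I False (\<lambda>i. bernoulli_pmf (w i))"
  assumes I: "finite I" and F: "F \<subseteq> I" and w: "\<And>i. i \<in> F \<Longrightarrow> w i \<in> {0..1}"
  shows "measure_pmf.prob M {X. card {i \<in> F. X i} < r} \<le> 2 ^ r * exp (- (\<Sum>i\<in>F. w i) / 2)"
proof -
  have "finite F" using F I finite_subset by blast
  then have "measure_pmf.prob M {X. card {i \<in> F. X i} < r} \<le> 2 ^ r * (\<Prod>i\<in>F. 1 - w i / 2)"
    using F w
  proof (induction F arbitrary: r rule: finite_induct)
    case empty
    show ?case
      by (cases r) (auto simp del: power_Suc intro!: one_le_power)
  next
    case (insert e F)
    let ?\<Pi> = "\<Prod>i\<in>F. 1 - w i / 2"
    show ?case
    proof (cases r)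
      case 0
      have "0 \<le> 1 - w i / 2" if "i \<in> insert e F" for i
        using insert.prems(2)[OF that] by auto
      then have "0 \<le> (\<Prod>i\<in>insert e F. 1 - w i / 2)" by (rule prod_nonneg)
      then show ?thesis using 0 by simp
    next
      case (Suc r')
      have we: "0 \<le> w e" "w e \<le> 1" using insert.prems(2)[of e] by auto
      have "measure_pmf.prob M {X. card {i \<in> insert e F. X i} < r} =
        (1 - w e) * measure_pmf.prob M {X. card {i \<in> F. X i} < Suc r'} +
        w e * measure_pmf.prob M {X. card {i \<in> F. X i} < r'}"
        unfolding M_def Suc by (rule bernoulli_count_recursion) (use insert I we in auto)
      also have "\<dots> \<le> (1 - w e) * (2 ^ Suc r' * ?\<Pi>) + w e * (2 ^ r' * ?\<Pi>)"
        by (intro add_mono mult_left_mono insert.IH) (use insert.prems we in auto)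
      also have "\<dots> = 2 ^ r * (\<Prod>i\<in>insert e F. 1 - w i / 2)"
        using insert.hyps by (simp add: Suc algebra_simps)
      finally show ?thesis .
    qed
  qed
  also have "(\<Prod>i\<in>F. 1 - w i / 2) \<le> (\<Prod>i\<in>F. exp (- w i / 2))"
  proof (rule prod_mono)
    fix i assume "i \<in> F"
    then show "0 \<le> 1 - w i / 2 \<and> 1 - w i / 2 \<le> exp (- w i / 2)"
      using w[of i] exp_ge_add_one_self[of "- w i / 2"] by auto
  qed
  also have "\<dots> = exp (- (\<Sum>i\<in>F. w i) / 2)"
    using \<open>finite F\<close> by (simp add: sum_negf sum_divide_distrib flip: exp_sum)
  finally show ?thesis by simp
qed

text \<open>A mean value bound: on the interval from \<open>y\<close> to \<open>y + q\<close> the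
  slope of \<open>max 0 t ^ Suc r\<close> is largest at the right end.\<close>

lemma pos_part_power_increment:
  fixes y q :: real
  assumes "0 \<le> q"
  shows "max 0 (y + q) ^ Suc r - max 0 y ^ Suc r \<le> real (Suc r) * q * max 0 (y + q) ^ r"
proof -
  let ?b = "max 0 (y + q)" and ?a = "max 0 y"
  have ab: "0 \<le> ?a" "?a \<le> ?b" "?b - ?a \<le> q" using assms by auto
  have "?b ^ p * ?a ^ (r - p) \<le> ?b ^ r" if "p \<in> {..<Suc r}" for p
  proof -
    have "?b ^ p * ?a ^ (r - p) \<le> ?b ^ p * ?b ^ (r - p)"
      using ab by (intro mult_left_mono power_mono) auto
    also have "\<dots> = ?b ^ r" using that by (simp flip: power_add)
    finally show ?thesis .
  qed
  then have "(\<Sum>p<Suc r. ?b ^ p * ?a ^ (r - p)) \<le> (\<Sum>p<Suc r. ?b ^ r)" by (rule sum_mono)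
  then have "(?b - ?a) * (\<Sum>p<Suc r. ?b ^ p * ?a ^ (r - p)) \<le> q * (\<Sum>p<Suc r. ?b ^ r)"
    using ab by (intro mult_mono sum_nonneg) auto
  moreover have "?b ^ Suc r - ?a ^ Suc r = (?b - ?a) * (\<Sum>p<Suc r. ?b ^ p * ?a ^ (r - p))"
    by (rule diff_power_eq_sum)
  moreover have "q * (\<Sum>p<Suc r. ?b ^ r) = real (Suc r) * q * ?b ^ r" by simp
  ultimately show ?thesis by (simp only: mult_ac)
qed

text \<open>Exactly \<open>r\<close> successes already have at least the probability
  \<open>\<Prod>i\<in>F. 1 - w i\<close> times the \<open>r\<close>-th elementary symmetric
  polynomial of the weights. That polynomial is at least the quotient in the bound: when
  \<open>r\<close> indices are chosen one after another, the remaining weights always add up to at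
  least the total minus \<open>r * m\<close>. The induction on \<open>F\<close> combines both
  estimates.\<close>

lemma bernoulli_count_ge:
  fixes w :: "'a \<Rightarrow> real" and I :: "'a set" and m :: real
  defines "M \<equiv> Pi_pmf I False (\<lambda>i. bernoulli_pmf (w i))"
  assumes I: "finite I" and F: "F \<subseteq> I" and w: "\<And>i. i \<in> F \<Longrightarrow> w i \<in> {0..1}" "\<And>i. i \<in> F \<Longrightarrow> w i \<le> m"
    and m: "0 \<le> m"
  shows "1 - measure_pmf.prob M {X. card {i \<in> F. X i} < r} \<ge>
    (\<Prod>i\<in>F. 1 - w i) * max 0 ((\<Sum>i\<in>F. w i) - r * m) ^ r / fact r"
proof -
  have "finite F" using F I finite_subset by blast
  then show ?thesis
    using F w
  proof (induction F arbitrary: r rule: finite_induct)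
    case empty
    show ?case using m by (cases r) auto
  next
    case (insert e F)
    let ?\<Pi> = "\<Prod>i\<in>F. 1 - w i" and ?s = "\<Sum>i\<in>F. w i"
    have \<Pi>: "0 \<le> ?\<Pi>" using insert.prems(2) by (intro prod_nonneg) auto
    have we: "0 \<le> w e" "w e \<le> 1" "w e \<le> m" using insert.prems(2,3)[of e] by auto
    show ?case
    proof (cases r)
      case 0
      have "(\<Prod>i\<in>insert e F. 1 - w i) \<le> 1"
        by (rule prod_le_1) (use insert.prems(2) in auto)
      then show ?thesis using 0 by simp
    next
      case (Suc r')
      let ?y = "?s - real (Suc r') * m"
      have IH1: "?\<Pi> * max 0 ?y ^ Suc r' / fact (Suc r') \<le> 1 - measure_pmf.prob M {X. card {i \<in> F. X i} < Suc r'}"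
        and IH2: "?\<Pi> * max 0 (?s - real r' * m) ^ r' / fact r' \<le> 1 - measure_pmf.prob M {X. card {i \<in> F. X i} < r'}"
        using insert.IH[of "Suc r'"] insert.IH[of r'] insert.prems by (auto simp del: power_Suc fact_Suc of_nat_Suc)
      have "max 0 (?y + w e) ^ Suc r' \<le> max 0 ?y ^ Suc r' + real (Suc r') * w e * max 0 (?y + w e) ^ r'"
        using pos_part_power_increment[OF we(1), of ?y r'] by linarith
      \<comment> \<open>Since \<open>w e \<le> m\<close>, adding \<open>w e\<close> to
        \<open>?y\<close> gives at most the shifted sum that belongs to \<open>r'\<close>, to which
        the second induction hypothesis applies.\<close>
      also have "max 0 (?y + w e) ^ r' \<le> max 0 (?s - real r' * m) ^ r'"
        using we by (intro power_mono) (auto simp: algebra_simps)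
      finally have step: "max 0 (?y + w e) ^ Suc r' \<le>
          max 0 ?y ^ Suc r' + real (Suc r') * w e * max 0 (?s - real r' * m) ^ r'"
        using we by (simp add: mult_left_mono)
      have "(\<Prod>i\<in>insert e F. 1 - w i) * max 0 ((\<Sum>i\<in>insert e F. w i) - r * m) ^ r / fact r
          = ((1 - w e) * ?\<Pi> / fact (Suc r')) * max 0 (?y + w e) ^ Suc r'"
        using insert.hyps by (simp add: Suc algebra_simps)
      also have "\<dots> \<le> ((1 - w e) * ?\<Pi> / fact (Suc r')) *
          (max 0 ?y ^ Suc r' + real (Suc r') * w e * max 0 (?s - real r' * m) ^ r')"
        using step we \<Pi> by (intro mult_left_mono) auto
      also have "\<dots> = (1 - w e) * (?\<Pi> * max 0 ?y ^ Suc r' / fact (Suc r')) +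
          (1 - w e) * w e * (?\<Pi> * max 0 (?s - real r' * m) ^ r' / fact r')"
        by (simp add: distrib_left add_divide_distrib mult_ac del: power_Suc of_nat_Suc)
      also have "\<dots> \<le> (1 - w e) * (?\<Pi> * max 0 ?y ^ Suc r' / fact (Suc r')) +
          w e * (?\<Pi> * max 0 (?s - real r' * m) ^ r' / fact r')"
        using we \<Pi> by (intro add_mono order_refl mult_right_mono) (auto simp: mult_left_le_one_le)
      also have "\<dots> \<le> (1 - w e) * (1 - measure_pmf.prob M {X. card {i \<in> F. X i} < Suc r'}) +
          w e * (1 - measure_pmf.prob M {X. card {i \<in> F. X i} < r'})"
        using we by (intro add_mono mult_left_mono IH1 IH2) auto
      also have "\<dots> = 1 - ((1 - w e) * measure_pmf.prob M {X. card {i \<in> F. X i} < Suc r'} +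
          w e * measure_pmf.prob M {X. card {i \<in> F. X i} < r'})"
        by (simp add: algebra_simps)
      also have "\<dots> = 1 - measure_pmf.prob M {X. card {i \<in> insert e F. X i} < Suc r'}"
        unfolding M_def by (subst bernoulli_count_recursion) (use insert I we in auto)
      finally show ?thesis by (simp add: Suc)
    qed
  qed
qed

text \<open>The Weierstrass product inequality. It is sharp when the total weight tends to 0;
  \<open>prod_one_minus_ge_exp\<close> serves total weights of constant order.\<close>

lemma prod_one_minus_ge:
  fixes f :: "'a \<Rightarrow> real"
  assumes "finite A" "\<And>x. x \<in> A \<Longrightarrow> f x \<in> {0..1}"
  shows "1 - sum f A \<le> (\<Prod>x\<in>A. 1 - f x)"
  using assms
proof (induction A rule: finite_induct)
  case (insert a A)
  have f: "0 \<le> f a" "f a \<le> 1" using insert.prems[of a] by auto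
  have "0 \<le> sum f A" using insert.prems by (intro sum_nonneg) auto
  then have "1 - sum f (insert a A) \<le> (1 - f a) * (1 - sum f A)"
    using f insert.hyps by (simp add: algebra_simps)
  also have "\<dots> \<le> (1 - f a) * (\<Prod>x\<in>A. 1 - f x)"
    using f insert by (intro mult_left_mono) auto
  finally show ?case using insert.hyps by simp
qed simp

lemma exp_one_power: "exp (1 :: real) ^ n = exp (real n)"
  using exp_of_nat_mult[of n "1 :: real"] by simp

lemma exp_neg_double_le:
  fixes x :: real
  assumes "0 \<le> x" "x \<le> 1 / 2"
  shows "exp (- 2 * x) \<le> 1 - x"
proof -
  have "- x - 2 * x\<^sup>2 \<le> ln (1 - x)" using ln_one_minus_pos_lower_bound[OF assms] .
  moreover have "x * x \<le> x * (1 / 2)" using assms by (intro mult_left_mono) auto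
  then have "2 * x\<^sup>2 \<le> x" by (simp add: power2_eq_square)
  ultimately have "- 2 * x \<le> ln (1 - x)" by linarith
  then show ?thesis using assms by (simp add: ln_ge_iff)
qed

lemma prod_one_minus_ge_exp:
  fixes f :: "'a \<Rightarrow> real"
  assumes "\<And>x. x \<in> A \<Longrightarrow> f x \<in> {0..1 / 2}"
  shows "exp (- 2 * sum f A) \<le> (\<Prod>x\<in>A. 1 - f x)"
proof (cases "finite A")
  case True
  have "exp (- 2 * sum f A) = (\<Prod>x\<in>A. exp (- 2 * f x))"
    using True by (simp add: sum_distrib_left flip: exp_sum)
  also have "\<dots> \<le> (\<Prod>x\<in>A. 1 - f x)"
    using assms exp_neg_double_le by (intro prod_mono) force
  finally show ?thesis .
qed simp

text \<open>Conditioning on the second component. It allows the seed set to be held fixed in all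
  estimates for the random graph.\<close>

lemma prob_pair_pmf_le:
  assumes "\<And>y. y \<in> set_pmf Q \<Longrightarrow> measure_pmf.prob P {x. R x y} \<le> b" "0 \<le> b"
  shows "measure_pmf.prob (pair_pmf P Q) {(x, y). R x y} \<le> b"
proof -
  have "pair_pmf P Q = bind_pmf Q (\<lambda>y. map_pmf (\<lambda>x. (x, y)) P)"
    unfolding pair_pmf_def map_pmf_def by (rule bind_commute_pmf)
  then have "emeasure (pair_pmf P Q) {(x, y). R x y} = (\<integral>\<^sup>+y. emeasure P {x. R x y} \<partial>Q)"
    by (simp add: vimage_def)
  also have "\<dots> \<le> (\<integral>\<^sup>+y. ennreal b \<partial>Q)"
    by (rule nn_integral_mono_AE)
      (use assms in \<open>auto simp: AE_measure_pmf_iff measure_pmf.emeasure_eq_measure\<close>)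
  finally show ?thesis using assms(2) by (simp add: measure_pmf.emeasure_eq_measure)
qed

section \<open>Random graphs with independent edges\<close>

definition edge :: "nat \<Rightarrow> nat \<Rightarrow> nat \<times> nat" where
  "edge u v = (min u v, max u v)"

lemma edge_eq_iff: "edge u v = edge u' v' \<longleftrightarrow> (u = u' \<and> v = v') \<or> (u = v' \<and> v = u')"
  by (auto simp: edge_def min_def max_def)

text \<open>The thinning argument works for arbitrary edge probabilities; the block model is the
  instance \<open>w u v = q n (c n u) (c n v)\<close>.\<close>

locale edge_model =
  fixes n r :: nat and w :: "nat \<Rightarrow> nat \<Rightarrow> real"
  assumes r_pos: "r \<ge> 1"
    and w_sym: "\<And>u v. u < n \<Longrightarrow> v < n \<Longrightarrow> w u v = w v u"
    and w_prob: "\<And>u v. u < n \<Longrightarrow> v < n \<Longrightarrow> w u v \<in> {0..1}"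
begin

definition slots :: "(nat \<times> nat) set" where
  "slots = {(u, v). u < v \<and> v < n}"

definition edge_pmf :: "(nat \<times> nat \<Rightarrow> bool) pmf" where
  "edge_pmf = Pi_pmf slots False (\<lambda>(u, v). bernoulli_pmf (w u v))"

text \<open>Testing membership in \<open>slots\<close> makes the graph finite and free of loops for
  every \<open>X\<close>, not only for those in the support of \<open>edge_pmf\<close>.\<close>

definition graph :: "(nat \<times> nat \<Rightarrow> bool) \<Rightarrow> (nat \<times> nat) set" where
  "graph X = {(u, v). edge u v \<in> slots \<and> X (edge u v)}"

definition resist :: "nat \<Rightarrow> nat set \<Rightarrow> real" where
  "resist v F = measure_pmf.prob edge_pmf {X. card {u \<in> F. (u, v) \<in> graph X} < r}"

definition spans :: "nat set \<Rightarrow> nat set \<Rightarrow> real" where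
  "spans S F = measure_pmf.prob edge_pmf {X. bootstrap_final r (graph X \<inter> F \<times> F) S = F}"

lemma finite_slots: "finite slots"
  by (rule finite_subset[of _ "{..<n} \<times> {..<n}"]) (auto simp: slots_def)

lemma graph_subset: "graph X \<subseteq> {..<n} \<times> {..<n}"
  by (auto simp: graph_def slots_def edge_def)

lemma finite_graph: "finite (graph X)"
  by (rule finite_subset[OF graph_subset]) simp

lemma edge_in_slots: "u < n \<Longrightarrow> v < n \<Longrightarrow> u \<noteq> v \<Longrightarrow> edge u v \<in> slots"
  by (auto simp: slots_def edge_def)

text \<open>By \<open>bootstrap_final_eq_iff\<close> the event is an intersection of events on
  disjoint sets of slots: those inside \<open>F\<close>, and for each \<open>v\<close> in
  \<open>W - F\<close> those joining \<open>v\<close> to \<open>F\<close>. The set \<open>W\<close>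
  will be the set of nodes that survive thinning.\<close>

lemma prob_final_eq:
  assumes SF: "S \<subseteq> F" and FW: "F \<subseteq> W" and W: "W \<subseteq> {..<n}"
  shows "measure_pmf.prob edge_pmf {X. bootstrap_final r (graph X \<inter> W \<times> W) S = F} =
    spans S F * (\<Prod>v\<in>W - F. resist v F)"
proof -
  let ?K = "{(u, v) \<in> slots. u \<in> F \<and> v \<in> F}" and ?J = "\<lambda>v. (\<lambda>u. edge u v) ` F"
  have "measure_pmf.prob edge_pmf {X. bootstrap_final r (graph X \<inter> W \<times> W) S = F} =
    measure_pmf.prob edge_pmf {X. bootstrap_final r (graph X \<inter> F \<times> F) S = F \<and>
      (\<forall>v\<in>W - F. card {u \<in> F. (u, v) \<in> graph X} < r)}"
    unfolding bootstrap_final_eq_iff[OF finite_graph r_pos SF FW] ..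
  also have "\<dots> = spans S F * (\<Prod>v\<in>W - F. resist v F)"
    unfolding spans_def resist_def edge_pmf_def
  proof (rule Pi_pmf_prob_conj_all[where K = ?K and J = ?J, OF finite_slots])
    show "finite (W - F)" using W finite_subset by blast
    show "disjoint_family_on ?J (W - F)"
      by (auto simp: disjoint_family_on_def edge_eq_iff)
    show "?K \<inter> ?J v = {}" if "v \<in> W - F" for v using that by (auto simp: edge_def min_def max_def split: if_splits)
    show "?J v \<subseteq> slots" if "v \<in> W - F" for v
      using that edge_in_slots W FW by blast
    show "(bootstrap_final r (graph X \<inter> F \<times> F) S = F) = (bootstrap_final r (graph Y \<inter> F \<times> F) S = F)"
      if eq: "\<And>i. i \<in> ?K \<Longrightarrow> X i = Y i" for X Y
    proof -
      have "X (edge u v) = Y (edge u v)" if "u \<in> F" "v \<in> F" "edge u v \<in> slots" for u v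
        by (rule eq) (use that in \<open>auto simp: edge_def min_def max_def\<close>)
      then have "graph X \<inter> F \<times> F = graph Y \<inter> F \<times> F" by (auto simp: graph_def)
      then show ?thesis by simp
    qed
    show "(card {u \<in> F. (u, v) \<in> graph X} < r) = (card {u \<in> F. (u, v) \<in> graph Y} < r)"
      if "v \<in> W - F" and eq: "\<And>i. i \<in> ?J v \<Longrightarrow> X i = Y i" for v X Y
    proof -
      have "X (edge u v) = Y (edge u v)" if "u \<in> F" for u by (rule eq) (use that in simp)
      then have "{u \<in> F. (u, v) \<in> graph X} = {u \<in> F. (u, v) \<in> graph Y}"
        by (auto simp: graph_def)
      then show ?thesis by simp
    qed
  qed auto
  finally show ?thesis .
qed

text \<open>
  Delete each node of \<open>U\<close> independently with probability \<open>1 - \<theta>\<close>. In the thinned graph the final set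
  is \<open>F\<close> with probability
  \<open>spans S F * \<theta> ^ card (U \<inter> F) * (\<Prod>v\<in>{..<n} - F - U. resist v F) * (\<Prod>v\<in>U - F. 1 - \<theta> + \<theta> * resist v F)\<close>,
  and these probabilities add up to at most 1. The factor \<open>spans S F\<close>, which is hard to estimate, is
  the same as in the original graph.
\<close>

lemma sum_thinned_le_1:
  assumes U: "U \<subseteq> {..<n} - S" and S: "S \<subseteq> {..<n}" and \<theta>: "0 \<le> \<theta>" "\<theta> \<le> 1"
    and \<F>: "\<F> \<subseteq> {F. S \<subseteq> F \<and> F \<subseteq> {..<n}}"
  shows "(\<Sum>F\<in>\<F>. spans S F * (\<theta> ^ card (U \<inter> F) * (\<Prod>v\<in>{..<n} - F - U. resist v F) *
      (\<Prod>v\<in>U - F. 1 - \<theta> + \<theta> * resist v F))) \<le> 1"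
proof -
  have fin: "finite U" "finite \<F>"
    using U finite_subset apply blast
    by (rule finite_subset[OF \<F>]) auto
  \<comment> \<open>The probability that \<open>D\<close> is exactly the set of deleted
    nodes.\<close>
  define wt where "wt D = (1 - \<theta>) ^ card D * \<theta> ^ card (U - D)" for D
  have wt: "0 \<le> wt D" for D using \<theta> by (simp add: wt_def)
  have thin: "\<theta> ^ card (U \<inter> F) * (\<Prod>v\<in>{..<n} - F - U. resist v F) * (\<Prod>v\<in>U - F. 1 - \<theta> + \<theta> * resist v F) =
      (\<Sum>D\<in>Pow (U - F). wt D * (\<Prod>v\<in>{..<n} - D - F. resist v F))" if "F \<in> \<F>" for F
  proof -
    have "(\<Prod>v\<in>U - F. 1 - \<theta> + \<theta> * resist v F) =
        (\<Sum>D\<in>Pow (U - F). (\<Prod>v\<in>D. 1 - \<theta>) * (\<Prod>v\<in>U - F - D. \<theta> * resist v F))"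
      by (rule prod_add) (use fin in auto)
    also have "\<theta> ^ card (U \<inter> F) * (\<Prod>v\<in>{..<n} - F - U. resist v F) * \<dots> =
      (\<Sum>D\<in>Pow (U - F). wt D * (\<Prod>v\<in>{..<n} - D - F. resist v F))"
      unfolding sum_distrib_left
    proof (rule sum.cong)
      fix D assume D: "D \<in> Pow (U - F)"
      have "U - D = (U \<inter> F) \<union> (U - F - D)" using D by auto
      then have "card (U - D) = card (U \<inter> F) + card (U - F - D)"
        by (simp only:) (rule card_Un_disjoint, use fin in auto)
      moreover have "{..<n} - D - F = ({..<n} - F - U) \<union> (U - F - D)" using D U by auto
      then have "(\<Prod>v\<in>{..<n} - D - F. resist v F) =
          (\<Prod>v\<in>{..<n} - F - U. resist v F) * (\<Prod>v\<in>U - F - D. resist v F)"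
        by (simp only:) (rule prod.union_disjoint, use fin in auto)
      ultimately show "\<theta> ^ card (U \<inter> F) * (\<Prod>v\<in>{..<n} - F - U. resist v F) *
          ((\<Prod>v\<in>D. 1 - \<theta>) * (\<Prod>v\<in>U - F - D. \<theta> * resist v F)) =
          wt D * (\<Prod>v\<in>{..<n} - D - F. resist v F)"
        by (simp add: wt_def prod.distrib power_add)
    qed simp
    finally show ?thesis .
  qed
  have "(\<Sum>F\<in>\<F>. spans S F * (\<theta> ^ card (U \<inter> F) * (\<Prod>v\<in>{..<n} - F - U. resist v F) *
      (\<Prod>v\<in>U - F. 1 - \<theta> + \<theta> * resist v F))) =
    (\<Sum>F\<in>\<F>. \<Sum>D\<in>{D \<in> Pow U. D \<inter> F = {}}. spans S F * (wt D * (\<Prod>v\<in>{..<n} - D - F. resist v F)))"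
  proof (rule sum.cong)
    fix F assume F: "F \<in> \<F>"
    have "Pow (U - F) = {D \<in> Pow U. D \<inter> F = {}}" by auto
    then show "spans S F * (\<theta> ^ card (U \<inter> F) * (\<Prod>v\<in>{..<n} - F - U. resist v F) *
        (\<Prod>v\<in>U - F. 1 - \<theta> + \<theta> * resist v F)) =
      (\<Sum>D\<in>{D \<in> Pow U. D \<inter> F = {}}. spans S F * (wt D * (\<Prod>v\<in>{..<n} - D - F. resist v F)))"
      unfolding thin[OF F] by (simp add: sum_distrib_left)
  qed simp
  also have "\<dots> = (\<Sum>D\<in>Pow U. \<Sum>F\<in>{F \<in> \<F>. D \<inter> F = {}}. spans S F * (wt D * (\<Prod>v\<in>{..<n} - D - F. resist v F)))"
    by (rule sum.swap_restrict) (use fin in auto)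
  \<comment> \<open>For a fixed deleted set \<open>D\<close> the events that the process on the
    surviving nodes ends in \<open>F\<close> are disjoint for different \<open>F\<close>, so their
    probabilities add up to at most 1.\<close>
  also have "\<dots> \<le> (\<Sum>D\<in>Pow U. wt D)"
  proof (rule sum_mono)
    fix D assume D: "D \<in> Pow U"
    let ?W = "{..<n} - D" and ?\<G> = "{F \<in> \<F>. D \<inter> F = {}}"
    let ?A = "\<lambda>F. {X. bootstrap_final r (graph X \<inter> ?W \<times> ?W) S = F}"
    have "(\<Sum>F\<in>?\<G>. spans S F * (wt D * (\<Prod>v\<in>?W - F. resist v F))) =
        wt D * (\<Sum>F\<in>?\<G>. spans S F * (\<Prod>v\<in>?W - F. resist v F))"
      by (simp add: sum_distrib_left mult_ac)
    also have "(\<Sum>F\<in>?\<G>. spans S F * (\<Prod>v\<in>?W - F. resist v F)) = (\<Sum>F\<in>?\<G>. measure_pmf.prob edge_pmf (?A F))"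
      by (rule sum.cong[OF refl], rule prob_final_eq[symmetric]) (use \<F> in auto)
    also have "\<dots> = measure_pmf.prob edge_pmf (\<Union>F\<in>?\<G>. ?A F)"
      by (rule measure_pmf.finite_measure_finite_Union[symmetric])
        (use fin in \<open>auto simp: disjoint_family_on_def\<close>)
    also have "wt D * \<dots> \<le> wt D" using wt[of D] by (simp add: mult_left_le)
    finally show "(\<Sum>F\<in>?\<G>. spans S F * (wt D * (\<Prod>v\<in>?W - F. resist v F))) \<le> wt D"
      using wt[of D] by (simp add: mult_left_mono)
  qed
  also have "\<dots> = (\<Prod>v\<in>U. (1 - \<theta>) + \<theta>)"
    unfolding prod_add[OF fin(1)] by (simp add: wt_def)
  finally show ?thesis by simp
qed

text \<open>A change of measure: \<open>bound\<close> says that each final set is at most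
  \<open>B\<close> times as likely in the original graph as in the thinned one, because
  \<open>spans S F\<close> and the factors of nodes outside \<open>U\<close> cancel. Summing over
  \<open>F\<close> leaves \<open>B\<close> times a total mass of at most 1.\<close>

lemma prob_final_in_le:
  assumes U: "U \<subseteq> {..<n} - S" and S: "S \<subseteq> {..<n}" and \<theta>: "0 \<le> \<theta>" "\<theta> \<le> 1" and B: "0 \<le> B"
    and bound: "\<And>F. F \<in> \<F> \<Longrightarrow> S \<subseteq> F \<Longrightarrow> F \<subseteq> {..<n} \<Longrightarrow>
      (\<Prod>v\<in>U - F. resist v F) \<le> B * (\<theta> ^ card (U \<inter> F) * (\<Prod>v\<in>U - F. 1 - \<theta> + \<theta> * resist v F))"
  shows "measure_pmf.prob edge_pmf {X. bootstrap_final r (graph X) S \<in> \<F>} \<le> B"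
proof -
  let ?\<G> = "{F \<in> \<F>. S \<subseteq> F \<and> F \<subseteq> {..<n}}" and ?V = "{..<n}"
  let ?A = "\<lambda>F. {X. bootstrap_final r (graph X \<inter> ?V \<times> ?V) S = F}"
  have fin: "finite ?\<G>" by (rule finite_subset[of _ "Pow ?V"]) auto
  have nn: "0 \<le> spans S F" "0 \<le> resist v F" for v F by (auto simp: spans_def resist_def)
  have final: "S \<subseteq> bootstrap_final r (graph X) S" "bootstrap_final r (graph X) S \<subseteq> ?V" for X
    using seeds_subset_bootstrap_final bootstrap_final_subset[OF finite_graph graph_subset S r_pos] by auto
  have gr: "graph X \<inter> ?V \<times> ?V = graph X" for X using graph_subset by blast
  have "{X. bootstrap_final r (graph X) S \<in> \<F>} = (\<Union>F\<in>?\<G>. ?A F)"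
    using final by (auto simp: gr)
  then have "measure_pmf.prob edge_pmf {X. bootstrap_final r (graph X) S \<in> \<F>} =
      (\<Sum>F\<in>?\<G>. measure_pmf.prob edge_pmf (?A F))"
    by (simp only:) (rule measure_pmf.finite_measure_finite_Union, use fin in \<open>auto simp: disjoint_family_on_def\<close>)
  also have "\<dots> = (\<Sum>F\<in>?\<G>. spans S F * (\<Prod>v\<in>?V - F. resist v F))"
    by (rule sum.cong[OF refl], rule prob_final_eq) auto
  also have "\<dots> \<le> (\<Sum>F\<in>?\<G>. B * (spans S F * (\<theta> ^ card (U \<inter> F) * (\<Prod>v\<in>?V - F - U. resist v F) *
      (\<Prod>v\<in>U - F. 1 - \<theta> + \<theta> * resist v F))))"
  proof (rule sum_mono)
    fix F assume F: "F \<in> ?\<G>"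
    let ?R = "\<Prod>v\<in>?V - F - U. resist v F"
    have "?V - F - (U - F) = ?V - F - U" by auto
    then have "(\<Prod>v\<in>?V - F. resist v F) = ?R * (\<Prod>v\<in>U - F. resist v F)"
      using prod.subset_diff[of "U - F" "?V - F" "\<lambda>v. resist v F"] U by auto
    then have "spans S F * (\<Prod>v\<in>?V - F. resist v F) = spans S F * ?R * (\<Prod>v\<in>U - F. resist v F)"
      by simp
    also have "\<dots> \<le> spans S F * ?R * (B * (\<theta> ^ card (U \<inter> F) * (\<Prod>v\<in>U - F. 1 - \<theta> + \<theta> * resist v F)))"
      using F by (intro mult_left_mono bound mult_nonneg_nonneg nn prod_nonneg) auto
    finally show "spans S F * (\<Prod>v\<in>?V - F. resist v F) \<le> B * (spans S F * (\<theta> ^ card (U \<inter> F) * ?R *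
      (\<Prod>v\<in>U - F. 1 - \<theta> + \<theta> * resist v F)))" by (simp add: mult_ac)
  qed
  also have "\<dots> \<le> B * 1"
    unfolding sum_distrib_left[symmetric]
    by (intro mult_left_mono sum_thinned_le_1[OF U S \<theta>] B) auto
  finally show ?thesis by simp
qed

section \<open>Bounds for the probability that a node stays inactive\<close>

lemma resist_eq:
  assumes v: "v < n" "v \<notin> F" and F: "F \<subseteq> {..<n}"
  defines "J \<equiv> (\<lambda>u. edge u v) ` F"
  shows "resist v F = measure_pmf.prob edge_pmf {X. card {i \<in> J. X i} < r}"
    and "inj_on (\<lambda>u. edge u v) F" and "J \<subseteq> slots"
    and "\<And>u. u \<in> F \<Longrightarrow> (\<lambda>(u, v). w u v) (edge u v) = w u v"
proof -
  show inj: "inj_on (\<lambda>u. edge u v) F" by (auto simp: inj_on_def edge_eq_iff)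
  have slots: "edge u v \<in> slots" if "u \<in> F" for u
    using edge_in_slots[of u v] that v F by auto
  then show "J \<subseteq> slots" by (auto simp: J_def)
  have "card {u \<in> F. (u, v) \<in> graph X} = card {i \<in> J. X i}" for X
  proof -
    have "{i \<in> J. X i} = (\<lambda>u. edge u v) ` {u \<in> F. (u, v) \<in> graph X}"
      using slots by (auto simp: J_def graph_def)
    moreover have "inj_on (\<lambda>u. edge u v) {u \<in> F. (u, v) \<in> graph X}"
      using inj by (rule inj_on_subset) auto
    ultimately show ?thesis by (simp add: card_image)
  qed
  then show "resist v F = measure_pmf.prob edge_pmf {X. card {i \<in> J. X i} < r}"
    by (simp add: resist_def)
  show "(\<lambda>(u, v). w u v) (edge u v) = w u v" if "u \<in> F" for u
    using w_sym[of u v] that v F by (auto simp: edge_def min_def max_def)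
qed

lemma resist_le_exp:
  assumes v: "v < n" "v \<notin> F" and F: "F \<subseteq> {..<n}"
  shows "resist v F \<le> 2 ^ r * exp (- (\<Sum>u\<in>F. w u v) / 2)"
proof -
  note eq = resist_eq[OF v F]
  let ?J = "(\<lambda>u. edge u v) ` F" and ?w = "\<lambda>(u, v). w u v"
  have wi: "?w i \<in> {0..1}" if i: "i \<in> ?J" for i
  proof -
    obtain u where "u \<in> F" "i = edge u v" using i by auto
    then show ?thesis using eq(4)[of u] w_prob[OF _ v(1), of u] F by auto
  qed
  have "resist v F \<le> 2 ^ r * exp (- (\<Sum>i\<in>?J. ?w i) / 2)"
    using bernoulli_count_less_le_exp[OF finite_slots eq(3), of ?w r] wi
    unfolding eq(1) edge_pmf_def by (simp add: case_prod_unfold)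
  also have "(\<Sum>i\<in>?J. ?w i) = (\<Sum>u\<in>F. w u v)"
    unfolding sum.reindex[OF eq(2)] by (rule sum.cong) (use eq(4) in auto)
  finally show ?thesis .
qed

lemma resist_le_poly:
  fixes m :: real
  assumes v: "v < n" "v \<notin> F" and F: "F \<subseteq> {..<n}" and m: "0 \<le> m" "\<And>u. u \<in> F \<Longrightarrow> w u v \<le> m"
  shows "(\<Prod>u\<in>F. 1 - w u v) * max 0 ((\<Sum>u\<in>F. w u v) - r * m) ^ r / fact r \<le> 1 - resist v F"
proof -
  note eq = resist_eq[OF v F]
  let ?J = "(\<lambda>u. edge u v) ` F" and ?w = "\<lambda>(u, v). w u v"
  have wi: "?w i \<in> {0..1}" "?w i \<le> m" if i: "i \<in> ?J" for i
  proof -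
    obtain u where u: "u \<in> F" "i = edge u v" using i by auto
    then show "?w i \<in> {0..1}" using eq(4)[of u] w_prob[OF _ v(1), of u] F by auto
    show "?w i \<le> m" using eq(4)[of u] u m(2)[of u] by auto
  qed
  have "(\<Prod>i\<in>?J. 1 - ?w i) * max 0 ((\<Sum>i\<in>?J. ?w i) - r * m) ^ r / fact r \<le> 1 - resist v F"
    using bernoulli_count_ge[OF finite_slots eq(3), of ?w m r] wi m
    unfolding eq(1) edge_pmf_def by (simp add: case_prod_unfold)
  moreover have "(\<Sum>i\<in>?J. ?w i) = (\<Sum>u\<in>F. w u v)"
    unfolding sum.reindex[OF eq(2)] by (rule sum.cong) (use eq(4) in auto)
  moreover have "(\<Prod>i\<in>?J. 1 - ?w i) = (\<Prod>u\<in>F. 1 - w u v)"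
    unfolding prod.reindex[OF eq(2)] by (rule prod.cong) (use eq(4) in auto)
  ultimately show ?thesis by simp
qed

text \<open>The hypothesis \<open>bound\<close> of \<open>prob_final_in_le\<close> for a single
  \<open>F\<close>, named so that different \<open>F\<close> can be handled with different
  \<open>U\<close> and \<open>\<theta>\<close>.\<close>

definition thinning_gain :: "nat set \<Rightarrow> real \<Rightarrow> real \<Rightarrow> nat set \<Rightarrow> bool" where
  "thinning_gain U \<theta> B F \<longleftrightarrow>
     (\<Prod>v\<in>U - F. resist v F) \<le> B * (\<theta> ^ card (U \<inter> F) * (\<Prod>v\<in>U - F. 1 - \<theta> + \<theta> * resist v F))"

lemma resist_range: "0 \<le> resist v F" "resist v F \<le> 1"
  by (auto simp: resist_def)

text \<open>With p the activation probability \<open>1 - resist v F\<close>, one has 1 - p \<le> exp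
  (- (1 - \<theta>) p) (1 - \<theta> p). So every node of \<open>U - F\<close> gains a factor
  \<open>exp (- (1 - \<theta>) * \<pi>)\<close>, against a cost of \<open>\<theta>\<close> for every
  node of \<open>U \<inter> F\<close>.\<close>

lemma thinning_gainI_exp:
  assumes \<theta>: "0 < \<theta>" "\<theta> \<le> 1"
    and \<pi>: "\<And>v. v \<in> U - F \<Longrightarrow> \<pi> \<le> 1 - resist v F"
    and B: "exp (- (1 - \<theta>) * \<pi> * card (U - F)) \<le> B * \<theta> ^ card (U \<inter> F)"
  shows "thinning_gain U \<theta> B F"
proof -
  let ?T = "\<Prod>v\<in>U - F. 1 - \<theta> + \<theta> * resist v F"
  have "(\<Prod>v\<in>U - F. resist v F) \<le> (\<Prod>v\<in>U - F. exp (- (1 - \<theta>) * \<pi>) * (1 - \<theta> + \<theta> * resist v F))"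
  proof (intro prod_mono conjI resist_range)
    fix v assume v: "v \<in> U - F"
    let ?p = "1 - resist v F"
    have T: "0 \<le> 1 - \<theta> * ?p"
      using \<theta> resist_range[of v F] by (simp add: mult_le_one)
    have "1 - ?p \<le> (1 - (1 - \<theta>) * ?p) * (1 - \<theta> * ?p)"
    proof -
      have "0 \<le> \<theta> * (1 - \<theta>) * (?p * ?p)" using \<theta> by (intro mult_nonneg_nonneg[of "\<theta> * (1 - \<theta>)"]) auto
      moreover have "(1 - (1 - \<theta>) * ?p) * (1 - \<theta> * ?p) = 1 - ?p + \<theta> * (1 - \<theta>) * (?p * ?p)"
        by algebra
      ultimately show ?thesis by linarith
    qed
    also have "\<dots> \<le> exp (- (1 - \<theta>) * ?p) * (1 - \<theta> * ?p)"
      using T exp_ge_add_one_self[of "- (1 - \<theta>) * ?p"] by (intro mult_right_mono) linarith+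
    also have "\<dots> \<le> exp (- (1 - \<theta>) * \<pi>) * (1 - \<theta> * ?p)"
    proof (intro mult_right_mono T)
      have "- (1 - \<theta>) * ?p \<le> - (1 - \<theta>) * \<pi>" using \<theta> by (intro mult_left_mono_neg \<pi>[OF v]) auto
      then show "exp (- (1 - \<theta>) * ?p) \<le> exp (- (1 - \<theta>) * \<pi>)" by (simp only: exp_le_cancel_iff)
    qed
    finally show "resist v F \<le> exp (- (1 - \<theta>) * \<pi>) * (1 - \<theta> + \<theta> * resist v F)"
      by (simp add: algebra_simps)
  qed
  also have "\<dots> = exp (- (1 - \<theta>) * \<pi> * card (U - F)) * ?T"
    unfolding prod.distrib prod_constant exp_of_nat_mult[symmetric] by (simp add: mult_ac)
  also have "\<dots> \<le> B * \<theta> ^ card (U \<inter> F) * ?T"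
    using \<theta> resist_range by (intro mult_right_mono B prod_nonneg) auto
  finally show ?thesis by (simp add: thinning_gain_def mult_ac)
qed

text \<open>For nodes that hardly ever stay inactive: the thinned factor is at least 1/2, so each
  node of \<open>U - F\<close> gains \<open>2 * \<eta>\<close>, which can be far smaller than the
  factor \<open>exp (- (1 - \<theta>) * \<pi>)\<close> of \<open>thinning_gainI_exp\<close>.\<close>

lemma thinning_gainI_half:
  assumes \<eta>: "\<And>v. v \<in> U - F \<Longrightarrow> resist v F \<le> \<eta>" "0 \<le> \<eta>"
    and B: "(2 * \<eta>) ^ card (U - F) \<le> B * (1 / 2) ^ card (U \<inter> F)"
  shows "thinning_gain U (1 / 2) B F"
proof -
  let ?T = "\<Prod>v\<in>U - F. 1 - 1 / 2 + 1 / 2 * resist v F"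
  have "(\<Prod>v\<in>U - F. resist v F) \<le> (\<Prod>v\<in>U - F. 2 * \<eta> * (1 - 1 / 2 + 1 / 2 * resist v F))"
  proof (intro prod_mono conjI resist_range)
    fix v assume v: "v \<in> U - F"
    have "0 \<le> \<eta> * resist v F" using \<eta>(2) resist_range by simp
    then show "resist v F \<le> 2 * \<eta> * (1 - 1 / 2 + 1 / 2 * resist v F)"
      using \<eta>(1)[OF v] by (simp add: algebra_simps)
  qed
  also have "\<dots> = (2 * \<eta>) ^ card (U - F) * ?T" by (simp add: prod.distrib)
  also have "\<dots> \<le> B * (1 / 2) ^ card (U \<inter> F) * ?T"
    using resist_range by (intro mult_right_mono B prod_nonneg) auto
  finally show ?thesis by (simp add: thinning_gain_def mult_ac)
qed

lemma thinning_gain_mono: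
  assumes "thinning_gain U \<theta> B F" "B \<le> B'" "0 \<le> \<theta>" "\<theta> \<le> 1"
  shows "thinning_gain U \<theta> B' F"
proof -
  have "0 \<le> \<theta> ^ card (U \<inter> F) * (\<Prod>v\<in>U - F. 1 - \<theta> + \<theta> * resist v F)"
    using assms resist_range by (intro mult_nonneg_nonneg prod_nonneg) auto
  then show ?thesis
    using assms(1) mult_right_mono[OF assms(2)] unfolding thinning_gain_def by (meson order_trans)
qed

text \<open>The union bound runs over the finitely many ways of thinning, not over the sets
  \<open>F\<close>, so it costs only the factor \<open>card T\<close>.\<close>

lemma prob_final_in_le_card:
  fixes B :: real
  assumes S: "S \<subseteq> {..<n}" and B: "0 \<le> B" and T: "finite T"
    and U: "\<And>i \<theta>. (i, \<theta>) \<in> T \<Longrightarrow> U i \<subseteq> {..<n} - S \<and> 0 \<le> \<theta> \<and> \<theta> \<le> 1"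
    and gain: "\<And>F. F \<in> \<F> \<Longrightarrow> S \<subseteq> F \<Longrightarrow> F \<subseteq> {..<n} \<Longrightarrow> \<exists>(i, \<theta>)\<in>T. thinning_gain (U i) \<theta> B F"
  shows "measure_pmf.prob edge_pmf {X. bootstrap_final r (graph X) S \<in> \<F>} \<le> card T * B"
proof -
  let ?A = "\<lambda>(i, \<theta>). {X. bootstrap_final r (graph X) S \<in> {F. thinning_gain (U i) \<theta> B F}}"
  have "{X. bootstrap_final r (graph X) S \<in> \<F>} \<subseteq> (\<Union>t\<in>T. ?A t)"
  proof
    fix X assume "X \<in> {X. bootstrap_final r (graph X) S \<in> \<F>}"
    then have "\<exists>(i, \<theta>)\<in>T. thinning_gain (U i) \<theta> B (bootstrap_final r (graph X) S)"
      using seeds_subset_bootstrap_final bootstrap_final_subset[OF finite_graph graph_subset S r_pos]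
      by (intro gain) auto
    then show "X \<in> (\<Union>t\<in>T. ?A t)" by auto
  qed
  then have "measure_pmf.prob edge_pmf {X. bootstrap_final r (graph X) S \<in> \<F>} \<le>
      measure_pmf.prob edge_pmf (\<Union>t\<in>T. ?A t)"
    by (rule measure_pmf.finite_measure_mono) simp
  also have "\<dots> \<le> (\<Sum>t\<in>T. measure_pmf.prob edge_pmf (?A t))"
    by (rule measure_pmf.finite_measure_subadditive_finite[OF T]) simp
  also have "\<dots> \<le> (\<Sum>t\<in>T. B)"
  proof (rule sum_mono)
    fix t assume t: "t \<in> T"
    obtain i \<theta> where [simp]: "t = (i, \<theta>)" by fastforce
    show "measure_pmf.prob edge_pmf (?A t) \<le> B"
      using U[of i \<theta>] t prob_final_in_le[of "U i" S \<theta> B "{F. thinning_gain (U i) \<theta> B F}"] S B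
      by (auto simp: thinning_gain_def)
  qed
  finally show ?thesis by simp
qed

end

section \<open>The supercritical condition\<close>

text \<open>By convexity the \<open>r\<close>-th power lies above its tangent at
  \<open>a\<close>.\<close>

lemma power_diff_ge_tangent:
  fixes a b :: real
  assumes "0 \<le> a" "a \<le> b"
  shows "real r * a ^ (r - 1) * (b - a) \<le> b ^ r - a ^ r"
proof (cases r)
  case (Suc s)
  have "(\<Sum>p<Suc s. a ^ s) \<le> (\<Sum>p<Suc s. b ^ p * a ^ (s - p))"
  proof (rule sum_mono)
    fix p assume "p \<in> {..<Suc s}"
    then have "a ^ s = a ^ p * a ^ (s - p)" by (simp flip: power_add)
    also have "\<dots> \<le> b ^ p * a ^ (s - p)" using assms by (intro mult_right_mono power_mono) auto
    finally show "a ^ s \<le> b ^ p * a ^ (s - p)" .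
  qed
  then have "(b - a) * (\<Sum>p<Suc s. a ^ s) \<le> (b - a) * (\<Sum>p<Suc s. b ^ p * a ^ (s - p))"
    using assms by (intro mult_left_mono) auto
  also have "\<dots> = b ^ Suc s - a ^ Suc s" by (rule diff_power_eq_sum[symmetric])
  finally show ?thesis by (simp add: Suc mult_ac)
qed simp

text \<open>
  The map \<open>x \<mapsto> x + rho x\<close> is monotone, so a point with \<open>rho \<le> 0\<close> forces a least such point \<open>y\<close>, which is
  a zero of \<open>rho\<close>. If \<open>y\<close> were outside \<open>region_D\<close>, then \<open>rho i\<close> would increase in the \<open>i\<close>-th coordinate at
  \<open>y\<close> for some \<open>i\<close>, and that coordinate could be lowered.
\<close>

lemma rho_pos_of_min_rho_pos:
  fixes M :: "nat \<Rightarrow> nat \<Rightarrow> real" and \<alpha> :: "nat \<Rightarrow> real"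
  assumes r: "r \<ge> 2" and k: "k \<ge> 1"
    and M: "\<And>i j. i \<in> {1..k} \<Longrightarrow> j \<in> {1..k} \<Longrightarrow> 0 \<le> M i j" "\<And>i. i \<in> {1..k} \<Longrightarrow> M i i = 1"
    and \<alpha>: "\<And>i. i \<in> {1..k} \<Longrightarrow> 0 \<le> \<alpha> i"
    and super: "min_rho r k M \<alpha> > 0"
    and x: "\<And>i. i \<in> {1..k} \<Longrightarrow> 0 \<le> x i"
  shows "\<exists>i\<in>{1..k}. rho r k M \<alpha> i x > 0"
proof (rule ccontr)
  assume "\<not> ?thesis"
  then have x_super: "rho r k M \<alpha> i x \<le> 0" if "i \<in> {1..k}" for i using that by force
  define c where "c = (1 / real r) * (1 - 1 / real r) ^ (r - 1)"
  have c: "c > 0" using r by (simp add: c_def)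
  define L where "L z i = (\<Sum>j\<in>{1..k}. M i j * z j)" for z i
  have rho: "rho r k M \<alpha> i z = \<alpha> i - z i + c * L z i ^ r" for z i
    by (simp add: rho_def c_def L_def)
  have L_nonneg: "0 \<le> L z i" if "\<And>j. j \<in> {1..k} \<Longrightarrow> 0 \<le> z j" "i \<in> {1..k}" for z i
    unfolding L_def using that M(1) by (intro sum_nonneg mult_nonneg_nonneg) auto
  have L_mono: "L z i \<le> L z' i" if "\<And>j. j \<in> {1..k} \<Longrightarrow> z j \<le> z' j" "i \<in> {1..k}" for z z' i
    unfolding L_def using that M(1) by (intro sum_mono mult_left_mono) auto
  define P where "P = {z. \<forall>i\<in>{1..k}. 0 \<le> z i \<and> rho r k M \<alpha> i z \<le> 0}"
  have xP: "x \<in> P" using x x_super by (auto simp: P_def)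
  \<comment> \<open>The coordinatewise infimum of \<open>P\<close>; the next steps show that it
    belongs to \<open>P\<close> and is a zero of \<open>rho\<close>.\<close>
  define y where "y i = Inf ((\<lambda>z. z i) ` P)" for i
  have y_le: "y i \<le> z i" if "z \<in> P" "i \<in> {1..k}" for z i
    unfolding y_def using that by (intro cInf_lower bdd_belowI2[of _ 0]) (auto simp: P_def)
  have y_greatest: "t \<le> y i" if "\<And>z. z \<in> P \<Longrightarrow> t \<le> z i" for t i
    unfolding y_def using that xP by (intro cInf_greatest) auto
  have y0: "0 \<le> y i" if "i \<in> {1..k}" for i
    using that by (intro y_greatest) (auto simp: P_def)
  have y_super: "rho r k M \<alpha> i y \<le> 0" if i: "i \<in> {1..k}" for i
  proof -
    \<comment> \<open>The map taking \<open>z\<close> to \<open>\<alpha> i + c * L z i ^ r\<close>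
      is monotone, so its value at \<open>y\<close> is a lower bound of the \<open>i\<close>-th
      coordinates of \<open>P\<close>.\<close>
    have "\<alpha> i + c * L y i ^ r \<le> y i"
    proof (rule y_greatest)
      fix z assume z: "z \<in> P"
      have "L y i ^ r \<le> L z i ^ r"
        using L_mono[of y z i] L_nonneg[of y i] y_le[OF z] y0 i by (intro power_mono) auto
      then have "c * L y i ^ r \<le> c * L z i ^ r" using c by simp
      moreover have "\<alpha> i + c * L z i ^ r \<le> z i" using z i unfolding P_def rho by force
      ultimately show "\<alpha> i + c * L y i ^ r \<le> z i" by linarith
    qed
    then show ?thesis by (simp add: rho)
  qed
  have y_zero: "rho r k M \<alpha> i y = 0" if i: "i \<in> {1..k}" for i
  proof -
    \<comment> \<open>One application of the monotone map to \<open>y\<close> yields a point of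
      \<open>P\<close> below \<open>y\<close>, and minimality of \<open>y\<close> gives
      equality.\<close>
    define z where "z i = \<alpha> i + c * L y i ^ r" for i
    have zy: "z j \<le> y j" if "j \<in> {1..k}" for j using y_super[OF that] by (simp add: rho z_def)
    have z0: "0 \<le> z j" if "j \<in> {1..k}" for j
      using \<alpha>[OF that] c L_nonneg[of y j] y0 that by (simp add: z_def)
    have "z \<in> P"
      unfolding P_def
    proof (intro CollectI ballI conjI z0)
      fix j assume j: "j \<in> {1..k}"
      have "L z j ^ r \<le> L y j ^ r"
        using L_mono[of z y j] L_nonneg[of z j] zy z0 j by (intro power_mono) auto
      then have "c * L z j ^ r \<le> c * L y j ^ r" using c by simp
      then show "rho r k M \<alpha> j z \<le> 0" by (simp add: rho z_def[of j])
    qed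
    then have "y i \<le> z i" using i by (rule y_le)
    then show ?thesis using zy[OF i] by (simp add: rho z_def)
  qed
  \<comment> \<open>At \<open>L z i = b\<close> the power term has slope
    \<open>c * real r * b ^ (r - 1) = 1\<close>, so beyond \<open>b\<close> the function
    \<open>rho i\<close> increases in its own coordinate.\<close>
  define b where "b = real r / (real r - 1)"
  have b: "b > 0" "(1 - 1 / real r) * b = 1" using r by (auto simp: b_def field_simps)
  have y_le_L: "y i \<le> L y i" if i: "i \<in> {1..k}" for i
  proof -
    have "M i i * y i \<le> L y i"
      unfolding L_def using i y0 M(1) by (intro member_le_sum) auto
    then show ?thesis using M(2)[OF i] by simp
  qed
  have L_le: "L y i \<le> b" if i: "i \<in> {1..k}" for i
  proof (rule ccontr)
    assume "\<not> L y i \<le> b"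
    then have Lb: "b < L y i" by simp
    have "0 < c * L y i ^ r" using c b Lb by (intro mult_pos_pos zero_less_power) auto
    then have yi: "0 < y i" using y_zero[OF i] \<alpha>[OF i] by (simp add: rho)
    \<comment> \<open>Lowering the coordinate by \<open>h\<close> keeps it nonnegative and keeps
      \<open>L\<close> at \<open>b\<close> or above, where the power term falls by at least
      \<open>h\<close>.\<close>
    define h where "h = min (L y i - b) (y i)"
    have h: "0 < h" "h \<le> L y i - b" "h \<le> y i" using Lb yi by (auto simp: h_def)
    define z where "z = y(i := y i - h)"
    have zy: "z j \<le> y j" for j using h by (simp add: z_def)
    have z0: "0 \<le> z j" if "j \<in> {1..k}" for j using h y0[OF that] by (simp add: z_def)
    have Lz: "L z i = L y i - h"
    proof -
      have "L z i = (\<Sum>j\<in>{1..k}. M i j * y j - (if j = i then M i i * h else 0))"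
        unfolding L_def by (rule sum.cong) (auto simp: z_def algebra_simps)
      also have "\<dots> = L y i - h" using i M(2)[OF i] by (simp add: sum_subtractf L_def)
      finally show ?thesis .
    qed
    have "z \<in> P"
      unfolding P_def
    proof (intro CollectI ballI conjI z0)
      fix j assume j: "j \<in> {1..k}"
      show "rho r k M \<alpha> j z \<le> 0"
      proof (cases "j = i")
        case False
        have "L z j ^ r \<le> L y j ^ r"
          using L_mono[of z y j] L_nonneg[of z j] zy z0 j by (intro power_mono) auto
        then have "c * L z j ^ r \<le> c * L y j ^ r" using c by simp
        then show ?thesis using y_super[OF j] False by (simp add: rho z_def)
      next
        case True
        have "h = c * (real r * b ^ (r - 1) * h)"
          using b(2) r unfolding c_def by (simp flip: power_mult_distrib add: mult_ac)
        also have "\<dots> \<le> c * (real r * (L y i - h) ^ (r - 1) * h)"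
          using c h b by (intro mult_left_mono mult_right_mono power_mono) auto
        also have "\<dots> \<le> c * (L y i ^ r - (L y i - h) ^ r)"
          using power_diff_ge_tangent[of "L y i - h" "L y i" r] h b c by (intro mult_left_mono) auto
        finally have "h \<le> c * L y i ^ r - c * (L y i - h) ^ r" by (simp add: algebra_simps)
        then show ?thesis using y_zero[OF i] True by (simp add: rho Lz) (simp add: z_def)
      qed
    qed
    then have "y i \<le> z i" using i by (rule y_le)
    then show False using h by (simp add: z_def)
  qed
  \<comment> \<open>Elements of \<open>region_D\<close> are extensional on \<open>{1..k}\<close>;
    \<open>rho\<close> reads only the coordinates in that set.\<close>
  define y' where "y' = restrict y {1..k}"
  have rho_y': "rho r k M \<alpha> i y' = 0" if "i \<in> {1..k}" for i
  proof -
    have "L y' i = L y i" unfolding L_def by (rule sum.cong) (auto simp: y'_def)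
    then show ?thesis using y_zero[OF that] that by (simp add: rho y'_def)
  qed
  have "y' \<in> region_D r k M"
    unfolding region_D_def
  proof (intro CollectI conjI ballI)
    show "y' \<in> {1..k} \<rightarrow>\<^sub>E {0..real r / (real r - 1)}"
      using y0 y_le_L L_le by (force simp: y'_def b_def)
    fix i assume i: "i \<in> {1..k}"
    have "L y i = y i + (\<Sum>j\<in>{1..k} - {i}. M i j * y j)"
      unfolding L_def using i M(2)[OF i] by (subst sum.remove[of _ i]) auto
    moreover have "(\<Sum>j\<in>{1..k} - {i}. M i j * y' j) = (\<Sum>j\<in>{1..k} - {i}. M i j * y j)"
      by (rule sum.cong) (auto simp: y'_def)
    ultimately show "y' i + (\<Sum>j\<in>{1..k} - {i}. M i j * y' j) \<le> real r / (real r - 1)"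
      using L_le[OF i] i by (simp add: y'_def b_def)
  qed
  then have "y' \<in> region_D_rho r k M \<alpha>" using rho_y' k by (simp add: region_D_rho_def)
  then have "min_rho r k M \<alpha> \<le> ereal (rho r k M \<alpha> 1 y')" unfolding min_rho_def by (rule INF_lower)
  moreover have "rho r k M \<alpha> 1 y' = 0" using k by (intro rho_y') auto
  ultimately show False using super by (simp add: zero_ereal_def)
qed

text \<open>Compactness: the sum of the positive parts of the \<open>rho i\<close> is continuous and
  positive on the cube, hence bounded below by a positive minimum, and some coordinate attains at
  least the average.\<close>

lemma rho_uniformly_pos_of_min_rho_pos:
  fixes M :: "nat \<Rightarrow> nat \<Rightarrow> real" and \<alpha> :: "nat \<Rightarrow> real" and K :: real
  assumes r: "r \<ge> 2" and k: "k \<ge> 1"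
    and M: "\<And>i j. i \<in> {1..k} \<Longrightarrow> j \<in> {1..k} \<Longrightarrow> 0 \<le> M i j" "\<And>i. i \<in> {1..k} \<Longrightarrow> M i i = 1"
    and \<alpha>: "\<And>i. i \<in> {1..k} \<Longrightarrow> 0 \<le> \<alpha> i"
    and super: "min_rho r k M \<alpha> > 0" and K: "0 \<le> K"
  obtains \<delta> where "0 < \<delta>"
    "\<And>x. (\<And>i. i \<in> {1..k} \<Longrightarrow> x i \<in> {0..K}) \<Longrightarrow> \<exists>i\<in>{1..k}. \<delta> \<le> rho r k M \<alpha> i x"
proof -
  \<comment> \<open>The cube is taken over all indices, where Tychonoff's theorem applies; points
    are later extended by 0 outside \<open>{1..k}\<close>.\<close>
  let ?C = "PiE UNIV (\<lambda>_. {0..K}) :: (nat \<Rightarrow> real) set"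
  let ?f = "\<lambda>x. \<Sum>i\<in>{1..k}. max 0 (rho r k M \<alpha> i x)"
  have "compactin (product_topology (\<lambda>_. euclidean) UNIV) ?C"
    by (subst compactin_PiE) simp
  then have "compact ?C" by (simp add: euclidean_product_topology)
  moreover have "continuous_on ?C ?f"
    unfolding rho_def
    by (intro continuous_intros continuous_on_subset[OF continuous_on_product_coordinates]) auto
  moreover have "(\<lambda>_. 0) \<in> ?C" using K by auto
  ultimately obtain y where y: "y \<in> ?C" "\<And>x. x \<in> ?C \<Longrightarrow> ?f y \<le> ?f x"
    using continuous_attains_inf[of ?C ?f] by (metis empty_iff)
  have "0 \<le> y i" for i using y(1) by auto
  then obtain i where "i \<in> {1..k}" "0 < rho r k M \<alpha> i y"
    using rho_pos_of_min_rho_pos[OF r k M \<alpha> super, of y] by auto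
  moreover have "max 0 (rho r k M \<alpha> i y) \<le> ?f y" if "i \<in> {1..k}" for i
    using that by (intro member_le_sum) auto
  ultimately have pos: "0 < ?f y" by force
  show ?thesis
  proof
    show "0 < ?f y / k" using pos k by simp
    fix x :: "nat \<Rightarrow> real" assume x: "\<And>i. i \<in> {1..k} \<Longrightarrow> x i \<in> {0..K}"
    let ?x = "\<lambda>i. if i \<in> {1..k} then x i else 0"
    have eq: "rho r k M \<alpha> i ?x = rho r k M \<alpha> i x" if "i \<in> {1..k}" for i
    proof -
      have "(\<Sum>j\<in>{1..k}. M i j * ?x j) = (\<Sum>j\<in>{1..k}. M i j * x j)" by (rule sum.cong) auto
      then show ?thesis using that unfolding rho_def by simp
    qed
    show "\<exists>i\<in>{1..k}. ?f y / k \<le> rho r k M \<alpha> i x"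
    proof (rule ccontr)
      assume "\<not> ?thesis"
      then have "max 0 (rho r k M \<alpha> i ?x) < ?f y / k" if "i \<in> {1..k}" for i
        using that eq[OF that] pos k by force
      then have "?f ?x < (\<Sum>i\<in>{1..k}. ?f y / k)"
        using k by (intro sum_strict_mono) auto
      also have "\<dots> = ?f y" using k by simp
      also have "\<dots> \<le> ?f ?x" using x K by (intro y(2)) auto
      finally show False by simp
    qed
  qed
qed

section \<open>Asymptotics of the stochastic block model\<close>

locale sbm =
  fixes r k :: nat
    and c :: "nat \<Rightarrow> nat \<Rightarrow> nat"
    and q :: "nat \<Rightarrow> nat \<Rightarrow> nat \<Rightarrow> real"
    and \<nu> \<gamma> \<mu> :: "nat \<Rightarrow> nat \<Rightarrow> real"
  assumes r: "r \<ge> 2" and k: "k \<ge> 1"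
    and labels: "\<And>n v. n \<ge> k \<Longrightarrow> v < n \<Longrightarrow> c n v \<in> {1..k}"
    and size_pos: "\<And>n i. n \<ge> k \<Longrightarrow> i \<in> {1..k} \<Longrightarrow> comm_size c n i \<ge> 1"
    and q_prob: "\<And>n i j. n \<ge> k \<Longrightarrow> i \<in> {1..k} \<Longrightarrow> j \<in> {1..k} \<Longrightarrow> q n i j \<in> {0..<1}"
    and q_sym: "\<And>n i j. n \<ge> k \<Longrightarrow> i \<in> {1..k} \<Longrightarrow> j \<in> {1..k} \<Longrightarrow> q n i j = q n j i"
    and size_lim: "\<And>i j. i \<in> {1..k} \<Longrightarrow> j \<in> {1..k} \<Longrightarrow>
          (\<lambda>n. real (comm_size c n i) / real (comm_size c n j)) \<longlonglongrightarrow> \<nu> i j"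
    and \<nu>_pos: "\<And>i j. i \<in> {1..k} \<Longrightarrow> j \<in> {1..k} \<Longrightarrow> \<nu> i j > 0"
    and p_lower: "\<And>i. i \<in> {1..k} \<Longrightarrow>
          (\<lambda>n. 1 / real (comm_size c n i)) \<in> o(\<lambda>n. q n i i)"
    and p_upper: "\<And>i. i \<in> {1..k} \<Longrightarrow>
          (\<lambda>n. q n i i) \<in> o(\<lambda>n. real (comm_size c n i) powr (- 1 / real r))"
    and q_le: "\<And>n i j. n \<ge> k \<Longrightarrow> i \<in> {1..k} \<Longrightarrow> j \<in> {1..k} \<Longrightarrow>
          q n i j \<le> min (q n i i) (q n j j)"
    and q_lim: "\<And>i j. i \<in> {1..k} \<Longrightarrow> j \<in> {1..k} \<Longrightarrow> (\<lambda>n. q n i j / q n i i) \<longlonglongrightarrow> \<gamma> i j"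
    and \<gamma>_range: "\<And>i j. i \<in> {1..k} \<Longrightarrow> j \<in> {1..k} \<Longrightarrow> \<gamma> i j \<in> {0..1}"
    and p_lim: "\<And>i j. i \<in> {1..k} \<Longrightarrow> j \<in> {1..k} \<Longrightarrow> (\<lambda>n. q n i i / q n j j) \<longlonglongrightarrow> \<mu> i j"
    and \<mu>_pos: "\<And>i j. i \<in> {1..k} \<Longrightarrow> j \<in> {1..k} \<Longrightarrow> \<mu> i j > 0"
begin

abbreviation N :: "nat \<Rightarrow> nat \<Rightarrow> real" where "N n i \<equiv> real (comm_size c n i)"
abbreviation g :: "nat \<Rightarrow> nat \<Rightarrow> real" where "g n i \<equiv> crit_size r c q n i"
abbreviation chi_mat :: "nat \<Rightarrow> nat \<Rightarrow> real" where "chi_mat \<equiv> chi r c q"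

definition rho_coeff :: real where
  "rho_coeff = (1 / real r) * (1 - 1 / real r) ^ (r - 1)"

lemma rho_coeff_pos: "rho_coeff > 0"
  using r by (simp add: rho_coeff_def)

section \<open>Limits of the edge probabilities and the critical sizes\<close>

lemma eventually_ge_k: "eventually (\<lambda>n. n \<ge> k) sequentially"
  by (rule eventually_ge_at_top)

text \<open>The positive function \<open>1 / N n i\<close> is negligible against
  \<open>q n i i\<close>, which therefore cannot vanish for large \<open>n\<close>.\<close>

lemma eventually_p_pos:
  assumes i: "i \<in> {1..k}"
  shows "eventually (\<lambda>n. q n i i > 0) sequentially"
proof -
  have "eventually (\<lambda>n. norm (1 / N n i) \<le> 1 * norm (q n i i)) sequentially"
    using landau_o.smallD[OF p_lower[OF i], of 1] by simp
  then show ?thesis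
    using eventually_ge_k
  proof eventually_elim
    case (elim n)
    then have "1 / N n i > 0" "0 \<le> q n i i" using size_pos[of n i] q_prob[of n i i] i by auto
    then show ?case using elim(1) by (metis abs_of_nonneg less_imp_le mult_1 order_less_le_trans real_norm_def)
  qed
qed

lemma inverse_Np_tendsto: "i \<in> {1..k} \<Longrightarrow> (\<lambda>n. 1 / (N n i * q n i i)) \<longlonglongrightarrow> 0"
  using smalloD_tendsto[OF p_lower] by simp

lemma Np_at_top:
  assumes i: "i \<in> {1..k}"
  shows "filterlim (\<lambda>n. N n i * q n i i) at_top sequentially"
proof -
  have "eventually (\<lambda>n. 0 < 1 / (N n i * q n i i)) sequentially"
    using eventually_p_pos[OF i] eventually_ge_k
    by eventually_elim (use size_pos[OF _ i] in force)
  from filterlim_inverse_at_top[OF inverse_Np_tendsto[OF i] this] show ?thesis by simp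
qed

lemma Npr_tendsto:
  assumes i: "i \<in> {1..k}"
  shows "(\<lambda>n. N n i * q n i i ^ r) \<longlonglongrightarrow> 0"
proof -
  have "(\<lambda>n. (q n i i / N n i powr (- 1 / r)) ^ r) \<longlonglongrightarrow> 0 ^ r"
    by (intro tendsto_power smalloD_tendsto p_upper i)
  moreover have "(q n i i / N n i powr (- 1 / r)) ^ r = N n i * q n i i ^ r" if "n \<ge> k" for n
  proof -
    have "0 < N n i" using size_pos[OF that i] by simp
    then have "(N n i powr (- 1 / r)) ^ r = N n i powr (- 1)"
      using r by (simp add: powr_power)
    also have "\<dots> = 1 / N n i" using \<open>0 < N n i\<close> by (simp add: powr_minus divide_inverse)
    finally have "(N n i powr (- 1 / r)) ^ r = 1 / N n i" .
    then show ?thesis by (simp add: power_divide)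
  qed
  then have "eventually (\<lambda>n. (q n i i / N n i powr (- 1 / r)) ^ r = N n i * q n i i ^ r) sequentially"
    by (rule eventually_mono[OF eventually_ge_k])
  ultimately have "(\<lambda>n. N n i * q n i i ^ r) \<longlonglongrightarrow> 0 ^ r" by (rule Lim_transform_eventually)
  then show ?thesis using r by (simp add: power_0_left)
qed

lemma p_tendsto_0:
  assumes i: "i \<in> {1..k}"
  shows "(\<lambda>n. q n i i) \<longlonglongrightarrow> 0"
proof (rule tendsto_sandwich)
  show "eventually (\<lambda>n. 0 \<le> q n i i) sequentially"
    using eventually_p_pos[OF i] by eventually_elim simp
  show "eventually (\<lambda>n. q n i i \<le> q n i i / N n i powr (- 1 / r)) sequentially"
    using eventually_p_pos[OF i] eventually_ge_k
  proof eventually_elim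
    case (elim n)
    have "1 \<le> N n i" using size_pos[OF elim(2) i] by simp
    then have "N n i powr (- 1 / r) \<le> 1" "0 < N n i powr (- 1 / r)"
      using powr_mono[of "- 1 / r" 0 "N n i"] r by auto
    then show ?case using elim(1) by (simp add: field_simps)
  qed
  show "(\<lambda>n. q n i i / N n i powr (- 1 / r)) \<longlonglongrightarrow> 0" by (rule smalloD_tendsto[OF p_upper[OF i]])
qed simp

lemma crit_size_pos:
  assumes "n \<ge> k" "i \<in> {1..k}" "q n i i > 0"
  shows "g n i > 0"
  using assms r size_pos[of n i] by (auto simp: crit_size_def intro!: mult_pos_pos)

lemma eventually_crit_size_pos:
  assumes i: "i \<in> {1..k}"
  shows "eventually (\<lambda>n. g n i > 0) sequentially"
  using eventually_p_pos[OF i] eventually_ge_k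
  by eventually_elim (use crit_size_pos[OF _ i] in auto)

text \<open>The origin of the power term of \<open>rho\<close>: with \<open>x * g n i\<close> active
  nodes in the community, the leading-order number of nodes with \<open>r\<close> active neighbours
  is \<open>N n i * (q n i i * (x * g n i)) ^ r / fact r\<close>, and this identity turns it into
  \<open>rho_coeff * x ^ r * g n i\<close>.\<close>

lemma crit_size_power:
  assumes "n \<ge> k" "i \<in> {1..k}" "q n i i > 0"
  shows "N n i * q n i i ^ r * g n i ^ r = rho_coeff * fact r * g n i"
proof -
  let ?y = "fact (r - 1) / (N n i * q n i i ^ r)"
  have N: "0 < N n i" using size_pos[OF assms(1,2)] by simp
  have y: "?y > 0" using N assms by simp
  have "(?y powr (1 / (real r - 1))) ^ (r - 1) = ?y powr (real (r - 1) * (1 / (real r - 1)))"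
    using y by (intro powr_power) linarith
  also have "real (r - 1) * (1 / (real r - 1)) = 1" using r by (simp add: of_nat_diff)
  also have "?y powr 1 = ?y" using y by (intro powr_one) linarith
  finally have "g n i ^ (r - 1) = (1 - 1 / real r) ^ (r - 1) * ?y"
    by (simp add: crit_size_def power_mult_distrib)
  then have "N n i * q n i i ^ r * g n i ^ (r - 1) = (1 - 1 / real r) ^ (r - 1) * fact (r - 1)"
    using N assms(3) by simp
  moreover have "g n i ^ r = g n i ^ (r - 1) * g n i" using r by (cases r) auto
  moreover have "fact r = real r * fact (r - 1)" using r by (cases r) auto
  ultimately show ?thesis using r by (simp add: rho_coeff_def mult_ac)
qed

lemma crit_size_at_top:
  assumes i: "i \<in> {1..k}"
  shows "filterlim (\<lambda>n. g n i) at_top sequentially"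
proof -
  have "(\<lambda>n. N n i * q n i i ^ r / fact (r - 1)) \<longlonglongrightarrow> 0"
    using tendsto_divide[OF Npr_tendsto[OF i] tendsto_const, of "fact (r - 1)"] by simp
  moreover have "eventually (\<lambda>n. 0 < N n i * q n i i ^ r / fact (r - 1)) sequentially"
    using eventually_p_pos[OF i] eventually_ge_k
    by eventually_elim (use size_pos[OF _ i] in force)
  ultimately have lim: "filterlim (\<lambda>n. fact (r - 1) / (N n i * q n i i ^ r)) at_top sequentially"
    using filterlim_inverse_at_top by fastforce
  have "filterlim (\<lambda>n. exp (1 / (real r - 1) * ln (fact (r - 1) / (N n i * q n i i ^ r)))) at_top sequentially"
    by (intro filterlim_compose[OF exp_at_top] filterlim_tendsto_pos_mult_at_top[OF tendsto_const]
        filterlim_compose[OF ln_at_top lim]) (use r in auto)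
  moreover have "eventually (\<lambda>n. exp (1 / (real r - 1) * ln (fact (r - 1) / (N n i * q n i i ^ r))) =
      (fact (r - 1) / (N n i * q n i i ^ r)) powr (1 / (real r - 1))) sequentially"
    using eventually_p_pos[OF i] eventually_ge_k
    by eventually_elim (use size_pos[OF _ i] in \<open>force simp: powr_def\<close>)
  ultimately have "filterlim (\<lambda>n. (fact (r - 1) / (N n i * q n i i ^ r)) powr (1 / (real r - 1))) at_top sequentially"
    by (simp add: filterlim_cong)
  then show ?thesis
    unfolding crit_size_def
    by (rule filterlim_tendsto_pos_mult_at_top[OF tendsto_const, rotated]) (use r in auto)
qed

text \<open>Moving the factor \<open>q n i i\<close> under the root of order \<open>r - 1\<close>
  replaces \<open>N n i * q n i i ^ r\<close> by \<open>N n i * q n i i\<close>, which tends to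
  infinity.\<close>

lemma p_crit_size_tendsto:
  assumes i: "i \<in> {1..k}"
  shows "(\<lambda>n. q n i i * g n i) \<longlonglongrightarrow> 0"
proof -
  have lim: "(\<lambda>n. fact (r - 1) * (1 / (N n i * q n i i))) \<longlonglongrightarrow> 0"
    using tendsto_mult[OF tendsto_const inverse_Np_tendsto[OF i], of "fact (r - 1)"] by simp
  have nonneg: "eventually (\<lambda>n. 0 \<le> fact (r - 1) * (1 / (N n i * q n i i))) sequentially"
    using eventually_p_pos[OF i] by eventually_elim simp
  have "(\<lambda>n. (fact (r - 1) * (1 / (N n i * q n i i))) powr (1 / (real r - 1))) \<longlonglongrightarrow> 0"
    by (rule tendsto_zero_powrI[OF lim tendsto_const nonneg]) (use r in auto)
  then have "(\<lambda>n. (1 - 1 / real r) * (fact (r - 1) * (1 / (N n i * q n i i))) powr (1 / (real r - 1))) \<longlonglongrightarrow> 0"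
    using tendsto_mult[OF tendsto_const, of _ 0] by fastforce
  moreover have "eventually (\<lambda>n. (1 - 1 / real r) * (fact (r - 1) * (1 / (N n i * q n i i))) powr (1 / (real r - 1)) =
      q n i i * g n i) sequentially"
    using eventually_p_pos[OF i] eventually_ge_k
  proof eventually_elim
    case (elim n)
    let ?p = "q n i i" and ?e = "1 / (real r - 1)"
    have N: "0 < N n i" using size_pos[OF elim(2) i] by simp
    have "?p = (?p ^ (r - 1)) powr ?e"
      using elim r by (simp add: powr_powr of_nat_diff flip: powr_realpow)
    moreover have "?p ^ r = ?p ^ (r - 1) * ?p" using r by (cases r) auto
    ultimately have "?p * (fact (r - 1) / (N n i * ?p ^ r)) powr ?e =
        (?p ^ (r - 1) * (fact (r - 1) / (N n i * ?p ^ r))) powr ?e"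
      using elim N by (metis powr_mult zero_le_power less_imp_le divide_nonneg_nonneg fact_ge_zero
          mult_nonneg_nonneg)
    also have "?p ^ (r - 1) * (fact (r - 1) / (N n i * ?p ^ r)) = fact (r - 1) * (1 / (N n i * ?p))"
      using \<open>?p ^ r = ?p ^ (r - 1) * ?p\<close> elim(1) by simp
    finally show ?case by (simp add: crit_size_def)
  qed
  ultimately show ?thesis by (rule Lim_transform_eventually)
qed

lemma crit_size_over_N_tendsto:
  assumes i: "i \<in> {1..k}"
  shows "(\<lambda>n. g n i / N n i) \<longlonglongrightarrow> 0"
proof -
  have "(\<lambda>n. (q n i i * g n i) * (1 / (N n i * q n i i))) \<longlonglongrightarrow> 0 * 0"
    by (intro tendsto_mult p_crit_size_tendsto inverse_Np_tendsto i)
  moreover have "eventually (\<lambda>n. (q n i i * g n i) * (1 / (N n i * q n i i)) = g n i / N n i) sequentially"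
    using eventually_p_pos[OF i] by eventually_elim simp
  ultimately show ?thesis by (simp add: Lim_transform_eventually)
qed

lemma crit_size_ratio_tendsto:
  assumes i: "i \<in> {1..k}" and j: "j \<in> {1..k}"
  shows "(\<lambda>n. g n j / g n i) \<longlonglongrightarrow> (\<nu> i j * \<mu> i j ^ r) powr (1 / (real r - 1))"
proof -
  have "(\<lambda>n. (N n i / N n j * (q n i i / q n j j) ^ r) powr (1 / (real r - 1))) \<longlonglongrightarrow>
      (\<nu> i j * \<mu> i j ^ r) powr (1 / (real r - 1))"
    using \<nu>_pos[OF i j] \<mu>_pos[OF i j]
    by (intro tendsto_powr tendsto_mult tendsto_power size_lim p_lim i j tendsto_const) auto
  moreover have "eventually (\<lambda>n. (N n i / N n j * (q n i i / q n j j) ^ r) powr (1 / (real r - 1)) =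
      g n j / g n i) sequentially"
    using eventually_p_pos[OF i] eventually_p_pos[OF j] eventually_ge_k
  proof eventually_elim
    case (elim n)
    have N: "0 < N n i" "0 < N n j" using size_pos[OF elim(3)] i j by force+
    have "g n j / g n i = ((fact (r - 1) / (N n j * q n j j ^ r)) / (fact (r - 1) / (N n i * q n i i ^ r))) powr (1 / (real r - 1))"
      unfolding crit_size_def using r N elim by (subst powr_divide) auto
    also have "(fact (r - 1) / (N n j * q n j j ^ r)) / (fact (r - 1) / (N n i * q n i i ^ r)) =
        N n i / N n j * (q n i i / q n j j) ^ r"
      by (simp add: power_divide)
    finally show ?case ..
  qed
  ultimately show ?thesis by (rule Lim_transform_eventually)
qed

section \<open>The matrix of limiting interactions between communities\<close>

lemma chi_tendsto_gamma:
  assumes i: "i \<in> {1..k}" and j: "j \<in> {1..k}"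
  shows "(\<lambda>n. (q n i j * g n j) / (q n i i * g n i)) \<longlonglongrightarrow>
    \<gamma> i j * (\<nu> i j * \<mu> i j ^ r) powr (1 / (real r - 1))"
  using tendsto_mult[OF q_lim[OF i j] crit_size_ratio_tendsto[OF i j]] by simp

text \<open>\<open>chi\<close> is defined through \<open>lim\<close>; the convergence just shown
  makes it the actual limit, with the closed form.\<close>

lemma chi_eq:
  assumes i: "i \<in> {1..k}" and j: "j \<in> {1..k}"
  shows "chi_mat i j = \<gamma> i j * (\<nu> i j * \<mu> i j ^ r) powr (1 / (real r - 1))"
  unfolding chi_def by (rule limI[OF chi_tendsto_gamma[OF i j]])

lemma chi_tendsto:
  "i \<in> {1..k} \<Longrightarrow> j \<in> {1..k} \<Longrightarrow> (\<lambda>n. (q n i j * g n j) / (q n i i * g n i)) \<longlonglongrightarrow> chi_mat i j"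
  by (simp add: chi_eq chi_tendsto_gamma)

lemma chi_nonneg: "i \<in> {1..k} \<Longrightarrow> j \<in> {1..k} \<Longrightarrow> 0 \<le> chi_mat i j"
  using \<gamma>_range[of i j] by (simp add: chi_eq)

lemma chi_diag:
  assumes i: "i \<in> {1..k}"
  shows "chi_mat i i = 1"
proof -
  have "eventually (\<lambda>n. 1 = (q n i i * g n i) / (q n i i * g n i)) sequentially"
    using eventually_p_pos[OF i] eventually_crit_size_pos[OF i] by eventually_elim simp
  then have "(\<lambda>n. (q n i i * g n i) / (q n i i * g n i)) \<longlonglongrightarrow> 1"
    by (rule Lim_transform_eventually[OF tendsto_const])
  then show ?thesis using chi_tendsto[OF i i] LIMSEQ_unique by blast
qed

text \<open>A nonzero entry forces \<open>\<gamma> i j > 0\<close>, so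
  \<open>q n i j * N n j\<close> has the same order as \<open>N n i * q n i i\<close>: a node of
  community \<open>i\<close> has an unbounded expected number of neighbours in community
  \<open>j\<close>.\<close>

lemma qN_at_top:
  assumes i: "i \<in> {1..k}" and j: "j \<in> {1..k}" and "chi_mat i j \<noteq> 0"
  shows "filterlim (\<lambda>n. q n i j * N n j) at_top sequentially"
proof -
  have pos: "0 < \<gamma> i j * \<nu> j i" using assms \<gamma>_range[OF i j] \<nu>_pos[OF j i] by (auto simp: chi_eq)
  have "filterlim (\<lambda>n. (q n i j / q n i i * (N n j / N n i)) * (N n i * q n i i)) at_top sequentially"
    by (rule filterlim_tendsto_pos_mult_at_top[OF _ pos Np_at_top[OF i]])
      (intro tendsto_mult q_lim size_lim i j)
  moreover have "eventually (\<lambda>n. (q n i j / q n i i * (N n j / N n i)) * (N n i * q n i i) = q n i j * N n j) sequentially"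
    using eventually_p_pos[OF i] eventually_ge_k
    by eventually_elim (use size_pos[OF _ i] in \<open>force simp: field_simps\<close>)
  ultimately show ?thesis by (simp add: filterlim_cong)
qed

text \<open>Bounds decaying in \<open>g n i\<close> are thereby converted into bounds decaying in
  \<open>g n 1\<close>.\<close>

lemma crit_size_dominates_first:
  assumes i: "i \<in> {1..k}"
  obtains l where "0 < l" "eventually (\<lambda>n. l * g n 1 \<le> g n i) sequentially"
proof -
  have 1: "1 \<in> {1..k}" using k by auto
  let ?L = "(\<nu> 1 i * \<mu> 1 i ^ r) powr (1 / (real r - 1))"
  have L: "0 < ?L" using \<nu>_pos[OF 1 i] \<mu>_pos[OF 1 i] by simp
  have "eventually (\<lambda>n. ?L / 2 < g n i / g n 1) sequentially"
    using crit_size_ratio_tendsto[OF 1 i] by (rule order_tendstoD) (use L in simp)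
  then have "eventually (\<lambda>n. ?L / 2 * g n 1 \<le> g n i) sequentially"
    using eventually_crit_size_pos[OF 1] by eventually_elim (simp add: field_simps)
  then show ?thesis using L that[of "?L / 2"] by simp
qed

text \<open>Prepares \<open>thinning_gainI_half\<close>, with \<open>l\<close> nodes of community
  \<open>i\<close> outside \<open>F\<close> and \<open>m\<close> non-seeds inside. A positive
  fraction of a linked community \<open>j\<close> makes \<open>\<sigma>\<close> tend to infinity, so
  at least \<open>\<epsilon> * N n i\<close> nodes each gain a small constant factor. This pays for
  at most \<open>N n i\<close> factors 1/2 and for \<open>exp (- g n i)\<close>.\<close>

lemma saturated_estimate:
  assumes i: "i \<in> {1..k}" and j: "j \<in> {1..k}" and ch: "chi_mat i j \<noteq> 0" and \<epsilon>: "0 < \<epsilon>"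
  shows "eventually (\<lambda>n. \<forall>\<sigma> m l. q n i j * (N n j / 16) \<le> \<sigma> \<longrightarrow> real m \<le> N n i \<longrightarrow> \<epsilon> * N n i \<le> real l \<longrightarrow>
    (2 * (2 ^ r * exp (- \<sigma> / 2))) ^ l \<le> exp (- g n i) * (1 / 2) ^ m) sequentially"
proof -
  \<comment> \<open>Chosen so that \<open>\<sigma> \<ge> ?L\<close> gives
    \<open>real r + 1 - \<sigma> / 2 \<le> - 2 / \<epsilon>\<close>; then \<open>l\<close> factors
    amount to at most \<open>exp (- 2 * N n i)\<close>, and
    \<open>g n i + m \<le> 2 * N n i\<close>.\<close>
  let ?L = "2 * (real r + 1) + 4 / \<epsilon>"
  have "eventually (\<lambda>n. 16 * ?L \<le> q n i j * N n j) sequentially"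
    using qN_at_top[OF i j ch] by (simp add: filterlim_at_top)
  moreover have "eventually (\<lambda>n. g n i / N n i < 1) sequentially"
    using crit_size_over_N_tendsto[OF i] by (rule order_tendstoD) simp
  ultimately show ?thesis
    using eventually_ge_k
  proof eventually_elim
    case (elim n)
    have N: "0 < N n i" using size_pos[OF elim(3) i] by simp
    have gN: "g n i \<le> N n i" using elim(2) N by (simp add: field_simps)
    show ?case
    proof (intro allI impI)
      fix \<sigma> :: real and m l :: nat
      assume \<sigma>: "q n i j * (N n j / 16) \<le> \<sigma>" and m: "real m \<le> N n i" and l: "\<epsilon> * N n i \<le> real l"
      have two: "(2::real) \<le> exp 1" using exp_ge_add_one_self[of 1] by simp
      have "2 * (2 ^ r * exp (- \<sigma> / 2)) = 2 ^ Suc r * exp (- \<sigma> / 2)" by simp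
      also have "\<dots> \<le> exp 1 ^ Suc r * exp (- \<sigma> / 2)"
        by (intro mult_right_mono power_mono two) auto
      also have "\<dots> = exp (real r + 1 - \<sigma> / 2)"
        unfolding exp_one_power exp_add[symmetric] by simp
      also have "\<dots> \<le> exp (- 2 / \<epsilon>)" using \<sigma> elim(1) by simp
      finally have "(2 * (2 ^ r * exp (- \<sigma> / 2))) ^ l \<le> exp (- 2 / \<epsilon>) ^ l" by (intro power_mono) auto
      also have "\<dots> = exp (- 2 / \<epsilon> * l)" unfolding exp_of_nat_mult[symmetric] by (simp add: mult_ac)
      also have "\<dots> \<le> exp (- g n i - m)"
      proof -
        have "2 * N n i \<le> 2 / \<epsilon> * l" using l \<epsilon> by (simp add: field_simps)
        then show ?thesis using m gN by simp
      qed
      also have "\<dots> = exp (- g n i) * (1 / exp 1) ^ m"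
        by (simp add: exp_diff power_divide exp_one_power)
      also have "\<dots> \<le> exp (- g n i) * (1 / 2) ^ m"
        using two by (intro mult_left_mono power_mono) (auto simp: field_simps)
      finally show "(2 * (2 ^ r * exp (- \<sigma> / 2))) ^ l \<le> exp (- g n i) * (1 / 2) ^ m" .
    qed
  qed
qed

text \<open>With \<open>s\<close> nodes of \<open>F\<close> in community \<open>i\<close>, the
  activation probability \<open>1 - Q\<close> exceeds a large multiple of \<open>s / N n i\<close>.
  For \<open>\<sigma> \<ge> M\<close> it is at least 1/2 and \<open>16 * s \<le> N n i\<close>
  suffices. For smaller \<open>\<sigma>\<close> the expected number of activations has order
  \<open>g n i * (s / g n i) ^ r\<close>, which is superlinear in \<open>s\<close> and wins once
  \<open>s / g n i \<ge> K\<close>.\<close>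

lemma intermediate_estimate:
  obtains K where "1 \<le> K"
    "\<And>i. i \<in> {1..k} \<Longrightarrow> eventually (\<lambda>n. \<forall>\<sigma> Q s. K * g n i \<le> s \<longrightarrow> 16 * s \<le> N n i \<longrightarrow> q n i i * s \<le> \<sigma> \<longrightarrow>
       Q \<le> 2 ^ r * exp (- \<sigma> / 2) \<longrightarrow>
       exp (- 2 * \<sigma>) * max 0 (\<sigma> - r * q n i i) ^ r / fact r \<le> 1 - Q \<longrightarrow>
       8 * s \<le> (1 - Q) * N n i) sequentially"
proof -
  \<comment> \<open>\<open>M\<close> makes \<open>2 ^ r * exp (- M / 2)\<close> at most
    \<open>exp (- 1)\<close>. \<open>K\<close> absorbs the required factor 8, the loss
    \<open>exp (- 2 * M)\<close> from absent edges and the loss \<open>2 ^ r\<close> from halving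
    the expected degree.\<close>
  define M where "M = 2 * (real r + 1)"
  define K where "K = max 1 (8 * exp (2 * M) * 2 ^ r / rho_coeff)"
  have K: "1 \<le> K" "8 * exp (2 * M) * 2 ^ r \<le> K * rho_coeff"
    using rho_coeff_pos by (auto simp: K_def max_def field_simps)
  have two: "(2::real) \<le> exp 1" using exp_ge_add_one_self[of 1] by simp
  show ?thesis
  proof
    show "1 \<le> K" by (rule K)
    fix i assume i: "i \<in> {1..k}"
    have "eventually (\<lambda>n. 2 * real r \<le> g n i) sequentially"
      using crit_size_at_top[OF i] by (simp add: filterlim_at_top)
    then show "eventually (\<lambda>n. \<forall>\<sigma> Q s. K * g n i \<le> s \<longrightarrow> 16 * s \<le> N n i \<longrightarrow> q n i i * s \<le> \<sigma> \<longrightarrow>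
       Q \<le> 2 ^ r * exp (- \<sigma> / 2) \<longrightarrow>
       exp (- 2 * \<sigma>) * max 0 (\<sigma> - r * q n i i) ^ r / fact r \<le> 1 - Q \<longrightarrow>
       8 * s \<le> (1 - Q) * N n i) sequentially"
      using eventually_ge_k eventually_p_pos[OF i]
    proof eventually_elim
      case (elim n)
      have N: "0 < N n i" using size_pos[OF elim(2) i] by simp
      have g: "0 < g n i" using crit_size_pos[OF elim(2) i elim(3)] .
      show ?case
      proof (intro allI impI)
        fix \<sigma> Q s :: real
        assume sK: "K * g n i \<le> s" and sN: "16 * s \<le> N n i" and \<sigma>: "q n i i * s \<le> \<sigma>"
          and Q1: "Q \<le> 2 ^ r * exp (- \<sigma> / 2)"
          and Q2: "exp (- 2 * \<sigma>) * max 0 (\<sigma> - r * q n i i) ^ r / fact r \<le> 1 - Q"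
        have gs: "g n i \<le> s" using sK mult_right_mono[OF K(1), of "g n i"] g by linarith
        then have s: "0 < s" using g by simp
        show "8 * s \<le> (1 - Q) * N n i"
        proof (cases "M \<le> \<sigma>")
          case True
          have "2 ^ r * exp (- \<sigma> / 2) \<le> exp 1 ^ r * exp (- (real r + 1))"
            using True two by (intro mult_mono power_mono) (auto simp: M_def)
          also have "\<dots> = exp (- 1)" unfolding exp_one_power exp_add[symmetric] by simp
          also have "\<dots> \<le> 1 / 2" using two by (simp add: exp_minus field_simps)
          finally have "1 / 2 \<le> 1 - Q" using Q1 by linarith
          then have "1 / 2 * N n i \<le> (1 - Q) * N n i" using N by (intro mult_right_mono) auto
          then show ?thesis using sN by simp
        next
          case False
          \<comment> \<open>Since \<open>s \<ge> g n i \<ge> 2 * r\<close>, the correction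
            \<open>r * q n i i\<close> is at most half of \<open>q n i i * s\<close>.\<close>
          have "q n i i * (2 * r) \<le> q n i i * s" using elim(1,3) gs by (intro mult_left_mono) auto
          then have half: "q n i i * s / 2 \<le> \<sigma> - r * q n i i" using \<sigma> by (simp add: mult_ac)
          have "(s / g n i) ^ (r - 1) \<ge> s / g n i"
            using self_le_power[of "s / g n i" "r - 1"] gs g r by simp
          moreover have "K \<le> s / g n i" using sK g by (simp add: field_simps)
          ultimately have pow: "K \<le> (s / g n i) ^ (r - 1)" by linarith
          have "8 * s * (exp (2 * M) * 2 ^ r) \<le> K * rho_coeff * s"
            using K(2) s by (simp add: mult_ac)
          also have "\<dots> \<le> (s / g n i) ^ (r - 1) * rho_coeff * s"
            using pow rho_coeff_pos s by (intro mult_right_mono) auto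
          also have "\<dots> = (s / g n i) ^ r * rho_coeff * g n i"
            using r g by (cases r) (auto simp: field_simps)
          also have "\<dots> = (s / g n i) ^ r * (N n i * q n i i ^ r * g n i ^ r) / fact r"
            using crit_size_power[OF elim(2) i elim(3)] by simp
          also have "\<dots> = N n i * (q n i i * s) ^ r / fact r"
            using g by (simp add: power_divide power_mult_distrib)
          finally have "8 * s \<le> N n i * (exp (- 2 * M) * ((q n i i * s / 2) ^ r / fact r))"
            by (simp add: exp_minus field_simps power_divide)
          also have "\<dots> \<le> N n i * (exp (- 2 * \<sigma>) * (max 0 (\<sigma> - r * q n i i) ^ r / fact r))"
            using False order_trans[OF half max.cobounded2[of _ 0]] elim(3) s N
            by (intro mult_left_mono mult_mono divide_right_mono power_mono) auto
          also have "\<dots> \<le> N n i * (1 - Q)" using Q2 N by (intro mult_left_mono) auto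
          finally show ?thesis by (simp add: mult_ac)
        qed
      qed
    qed
  qed
qed

text \<open>When \<open>F\<close> has the order of the critical size everywhere, the nodes of
  community \<open>i\<close> outside \<open>F\<close> expected to be activated number at least the
  power term of \<open>rho\<close> at the rescaled point, times \<open>g n i\<close>, up to an error
  \<open>\<delta> * g n i\<close>. The error is uniform because the rescaled points stay in a
  cube.\<close>

lemma critical_estimate:
  assumes i: "i \<in> {1..k}" and K: "0 \<le> K" and \<delta>: "0 < \<delta>"
  shows "eventually (\<lambda>n. \<forall>s Q. (\<forall>j\<in>{1..k}. 0 \<le> s j \<and> s j \<le> K * g n j) \<longrightarrow>
     (1 - (\<Sum>j\<in>{1..k}. q n i j * s j)) * max 0 ((\<Sum>j\<in>{1..k}. q n i j * s j) - r * q n i i) ^ r / fact r \<le> 1 - Q \<longrightarrow>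
     g n i * (rho_coeff * (\<Sum>j\<in>{1..k}. chi_mat i j * (s j / g n j)) ^ r - \<delta>) \<le> (1 - Q) * (N n i - s i)) sequentially"
proof -
  define ch where "ch n j = (q n i j * g n j) / (q n i i * g n i)" for n j
  define b where "b = K * (\<Sum>j\<in>{1..k}. chi_mat i j)"
  \<comment> \<open>\<open>err1\<close> bounds the expected degree into \<open>F\<close>,
    \<open>err2\<close> the fraction of community \<open>i\<close> inside \<open>F\<close>, and
    \<open>d\<close> the shortfall of the rescaled degree, after the shift by
    \<open>r * q n i i\<close>, against its limit.\<close>
  define err1 where "err1 n = q n i i * g n i * (K * (\<Sum>j\<in>{1..k}. ch n j))" for n
  define err2 where "err2 n = K * (g n i / N n i)" for n
  define d where "d n = K * (\<Sum>j\<in>{1..k}. \<bar>ch n j - chi_mat i j\<bar>) + r / g n i" for n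
  have ch_lim: "(\<lambda>n. ch n j) \<longlonglongrightarrow> chi_mat i j" if "j \<in> {1..k}" for j
    unfolding ch_def by (rule chi_tendsto[OF i that])
  have "(\<lambda>n. err1 n) \<longlonglongrightarrow> 0 * (K * (\<Sum>j\<in>{1..k}. chi_mat i j))"
    unfolding err1_def by (intro tendsto_intros p_crit_size_tendsto i ch_lim)
  then have err1: "err1 \<longlonglongrightarrow> 0" by simp
  have "(\<lambda>n. err2 n) \<longlonglongrightarrow> K * 0"
    unfolding err2_def by (intro tendsto_intros crit_size_over_N_tendsto i)
  then have err2: "err2 \<longlonglongrightarrow> 0" by simp
  have "(\<lambda>n. r / g n i) \<longlonglongrightarrow> 0"
    by (rule tendsto_divide_0[OF tendsto_const]) (rule filterlim_at_top_imp_at_infinity[OF crit_size_at_top[OF i]])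
  then have "(\<lambda>n. d n) \<longlonglongrightarrow> K * (\<Sum>j\<in>{1..k}. \<bar>chi_mat i j - chi_mat i j\<bar>) + 0"
    unfolding d_def by (intro tendsto_intros ch_lim)
  then have d: "d \<longlonglongrightarrow> 0" by simp
  \<comment> \<open>The first summand is the loss from lowering the base of the power by
    \<open>d n\<close>, the second the loss from the factors \<open>1 - err1 n\<close> and
    \<open>1 - err2 n\<close>.\<close>
  have "(\<lambda>n. rho_coeff * (r * d n * b ^ (r - 1)) + (err1 n + err2 n) * (rho_coeff * b ^ r)) \<longlonglongrightarrow>
      rho_coeff * (real r * 0 * b ^ (r - 1)) + (0 + 0) * (rho_coeff * b ^ r)"
    by (intro tendsto_intros d err1 err2)
  then have "eventually (\<lambda>n. rho_coeff * (r * d n * b ^ (r - 1)) + (err1 n + err2 n) * (rho_coeff * b ^ r) < \<delta>) sequentially"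
    by (rule order_tendstoD) (use \<delta> in simp)
  moreover have "eventually (\<lambda>n. err1 n < 1) sequentially" "eventually (\<lambda>n. err2 n < 1) sequentially"
    using order_tendstoD(2)[OF err1, of 1] order_tendstoD(2)[OF err2, of 1] by simp_all
  moreover have "eventually (\<lambda>n. \<forall>j\<in>{1..k}. g n j > 0) sequentially"
    by (intro eventually_ball_finite ballI eventually_crit_size_pos) auto
  ultimately show ?thesis
    using eventually_p_pos[OF i] eventually_ge_k
  proof eventually_elim
    case (elim n)
    note small = elim(1) and err1_1 = elim(2) and err2_1 = elim(3) and g = elim(4) and p = elim(5) and n = elim(6)
    have gi: "0 < g n i" and N: "0 < N n i" using g i size_pos[OF n i] by auto
    show ?case
    proof (intro allI impI)
      fix s :: "nat \<Rightarrow> real" and Q :: real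
      let ?\<sigma> = "\<Sum>j\<in>{1..k}. q n i j * s j"
      assume s: "\<forall>j\<in>{1..k}. 0 \<le> s j \<and> s j \<le> K * g n j"
        and Q: "(1 - ?\<sigma>) * max 0 (?\<sigma> - r * q n i i) ^ r / fact r \<le> 1 - Q"
      define x where "x j = s j / g n j" for j
      have x: "0 \<le> x j" "x j \<le> K" if "j \<in> {1..k}" for j
        using s g that by (auto simp: x_def field_simps)
      have chn: "0 \<le> ch n j" if "j \<in> {1..k}" for j
        unfolding ch_def
      proof (intro divide_nonneg_nonneg mult_nonneg_nonneg)
        show "0 \<le> q n i j" using q_prob[OF n i that] by auto
        show "0 \<le> g n j" using bspec[OF g that] by linarith
      qed (use p gi in auto)
      let ?X = "\<Sum>j\<in>{1..k}. chi_mat i j * x j" and ?Xn = "\<Sum>j\<in>{1..k}. ch n j * x j"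
      have \<sigma>: "?\<sigma> = q n i i * g n i * ?Xn"
        unfolding sum_distrib_left
      proof (rule sum.cong[OF refl])
        fix j assume "j \<in> {1..k}"
        then have "0 < g n j" using g by blast
        then show "q n i j * s j = q n i i * g n i * (ch n j * x j)" using gi p by (simp add: ch_def x_def)
      qed
      have "?Xn \<le> (\<Sum>j\<in>{1..k}. ch n j * K)" using x chn by (intro sum_mono mult_left_mono) auto
      then have "?Xn \<le> K * (\<Sum>j\<in>{1..k}. ch n j)" by (simp add: sum_distrib_left mult_ac)
      then have \<sigma>_le: "?\<sigma> \<le> err1 n" unfolding \<sigma> err1_def using p gi by (intro mult_left_mono) auto
      have s_le: "s i / N n i \<le> err2 n" using s i N by (auto simp: err2_def field_simps)
      have X0: "0 \<le> ?X" using x chi_nonneg[OF i] by (intro sum_nonneg mult_nonneg_nonneg) auto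
      have "?X \<le> (\<Sum>j\<in>{1..k}. chi_mat i j * K)" using x chi_nonneg[OF i] by (intro sum_mono mult_left_mono) auto
      then have Xb: "?X \<le> b" by (simp add: b_def sum_distrib_left mult_ac)
      have "?X - ?Xn = (\<Sum>j\<in>{1..k}. (chi_mat i j - ch n j) * x j)" by (simp add: sum_subtractf algebra_simps)
      also have "\<dots> \<le> (\<Sum>j\<in>{1..k}. \<bar>ch n j - chi_mat i j\<bar> * K)"
        using x by (intro sum_mono mult_mono) auto
      finally have Xd: "?X - d n \<le> ?Xn - r / g n i" by (simp add: d_def sum_distrib_left mult_ac)
      have d0: "0 \<le> d n" using K gi unfolding d_def by (intro add_nonneg_nonneg mult_nonneg_nonneg sum_nonneg) auto
      let ?z = "rho_coeff * max 0 (?X - d n) ^ r"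
      have "max 0 (?X - d n + d n) ^ Suc (r - 1) - max 0 (?X - d n) ^ Suc (r - 1) \<le>
          real (Suc (r - 1)) * d n * max 0 (?X - d n + d n) ^ (r - 1)"
        by (rule pos_part_power_increment[OF d0])
      then have "?X ^ r - max 0 (?X - d n) ^ r \<le> r * d n * ?X ^ (r - 1)" using r X0 by simp
      also have "\<dots> \<le> r * d n * b ^ (r - 1)" using d0 X0 Xb by (intro mult_left_mono power_mono) auto
      finally have "rho_coeff * (?X ^ r - max 0 (?X - d n) ^ r) \<le> rho_coeff * (r * d n * b ^ (r - 1))"
        using rho_coeff_pos by (intro mult_left_mono) auto
      then have z1: "rho_coeff * ?X ^ r - rho_coeff * (r * d n * b ^ (r - 1)) \<le> ?z" by (simp add: algebra_simps)
      have "max 0 (?X - d n) \<le> b" using X0 Xb d0 by auto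
      then have z2: "?z \<le> rho_coeff * b ^ r" using rho_coeff_pos by (intro mult_left_mono power_mono) auto
      have z0: "0 \<le> ?z" using rho_coeff_pos by simp
      have e0: "0 \<le> err1 n" "0 \<le> err2 n"
        using gi N p K chn unfolding err1_def err2_def by (auto intro!: mult_nonneg_nonneg sum_nonneg)
      have "rho_coeff * ?X ^ r - \<delta> \<le> ?z - (err1 n + err2 n) * (rho_coeff * b ^ r)"
        using z1 small by linarith
      also have "\<dots> \<le> ?z - (err1 n + err2 n) * ?z"
        using z2 e0 mult_left_mono[OF z2, of "err1 n + err2 n"] by linarith
      also have "\<dots> \<le> (1 - err1 n) * (1 - err2 n) * ?z"
        using e0 z0 mult_nonneg_nonneg[of "err1 n * err2 n" ?z] by (simp add: algebra_simps)
      also have "\<dots> \<le> (1 - ?\<sigma>) * (1 - s i / N n i) * (rho_coeff * max 0 (?Xn - r / g n i) ^ r)"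
        using \<sigma>_le s_le err1_1 err2_1 rho_coeff_pos Xd z0 by (intro mult_mono power_mono) auto
      finally have main: "g n i * (rho_coeff * ?X ^ r - \<delta>) \<le>
          g n i * ((1 - ?\<sigma>) * (1 - s i / N n i) * (rho_coeff * max 0 (?Xn - r / g n i) ^ r))"
        using gi by (intro mult_left_mono) auto
      have "max 0 (?\<sigma> - r * q n i i) = q n i i * g n i * max 0 (?Xn - r / g n i)"
      proof -
        have "?\<sigma> - r * q n i i = q n i i * g n i * (?Xn - r / g n i)"
          unfolding \<sigma> using gi by (simp add: algebra_simps)
        then show ?thesis using gi p by (simp add: max_mult_distrib_left)
      qed
      then have "N n i * max 0 (?\<sigma> - r * q n i i) ^ r = rho_coeff * fact r * g n i * max 0 (?Xn - r / g n i) ^ r"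
        using crit_size_power[OF n i p] by (simp add: power_mult_distrib)
      then have "g n i * ((1 - ?\<sigma>) * (1 - s i / N n i) * (rho_coeff * max 0 (?Xn - r / g n i) ^ r)) =
          (1 - ?\<sigma>) * (1 - s i / N n i) * (N n i * max 0 (?\<sigma> - r * q n i i) ^ r / fact r)"
        by simp
      also have "\<dots> = (1 - ?\<sigma>) * max 0 (?\<sigma> - r * q n i i) ^ r / fact r * (N n i - s i)"
        using N by (simp add: field_simps)
      also have "\<dots> \<le> (1 - Q) * (N n i - s i)"
      proof (rule mult_right_mono[OF Q])
        have "s i / N n i < 1" using s_le err2_1 by linarith
        then show "0 \<le> N n i - s i" using N by (simp add: field_simps)
      qed
      finally show "g n i * (rho_coeff * (\<Sum>j\<in>{1..k}. chi_mat i j * (s j / g n j)) ^ r - \<delta>) \<le> (1 - Q) * (N n i - s i)"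
        using main by (simp add: x_def)
    qed
  qed
qed

end

section \<open>Transfer from the block model to independent edges\<close>

lemma sbm_graph_eq:
  "sbm_graph c q n = map_pmf (edge_model.graph n)
     (edge_model.edge_pmf n (\<lambda>u v. q n (c n u) (c n v)))"
  if "edge_model n r (\<lambda>u v. q n (c n u) (c n v))"
proof -
  interpret edge_model n r "\<lambda>u v. q n (c n u) (c n v)" by fact
  \<comment> \<open>On the support, variables outside \<open>slots\<close> have the default value
    \<open>False\<close>; for arbitrary \<open>X\<close> the two graphs may differ.\<close>
  have "{(u, v). X (min u v, max u v)} = graph X" if "X \<in> set_pmf edge_pmf" for X
  proof -
    have "X e \<Longrightarrow> e \<in> slots" for e
      using that set_Pi_pmf_subset[OF finite_slots, of False] unfolding edge_pmf_def by blast
    then show ?thesis by (auto simp: graph_def edge_def)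
  qed
  then show ?thesis
    unfolding sbm_graph_def slots_def[symmetric] edge_pmf_def[symmetric] by (intro map_pmf_cong) auto
qed

lemma seeds_support:
  assumes le: "\<And>i. i \<in> {1..k} \<Longrightarrow> a n i \<le> comm_size c n i" and S: "S \<in> set_pmf (seeds k c a n)"
  shows "S \<subseteq> {..<n}" and "\<And>i. i \<in> {1..k} \<Longrightarrow> card (S \<inter> community c n i) = a n i"
proof -
  let ?T = "\<lambda>i. {T. T \<subseteq> community c n i \<and> card T = a n i}"
  have fin: "finite (community c n i)" for i by (rule finite_subset[of _ "{..<n}"]) (auto simp: community_def)
  obtain f where f: "f \<in> set_pmf (Pi_pmf {1..k} {} (\<lambda>i. pmf_of_set (?T i)))" and S_eq: "S = (\<Union>i\<in>{1..k}. f i)"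
    using S by (auto simp: seeds_def)
  have fT: "f i \<in> ?T i" if i: "i \<in> {1..k}" for i
  proof -
    \<comment> \<open>The support of \<open>pmf_of_set\<close> is known for finite nonempty sets;
      the bound on \<open>a n i\<close> provides nonemptiness.\<close>
    have "\<exists>T\<subseteq>community c n i. card T = a n i"
      using le[OF i] unfolding comm_size_def by (metis obtain_subset_with_card_n)
    moreover have "finite (?T i)" using fin[of i] by simp
    ultimately have "set_pmf (pmf_of_set (?T i)) = ?T i" by (intro set_pmf_of_set) auto
    moreover have "f i \<in> set_pmf (pmf_of_set (?T i))"
      using f i by (auto simp: set_Pi_pmf PiE_dflt_def)
    ultimately show ?thesis by simp
  qed
  then show "S \<subseteq> {..<n}" unfolding S_eq community_def by blast
  fix i assume i: "i \<in> {1..k}"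
  have "S \<inter> community c n i = f i"
    using fT i unfolding S_eq community_def by blast
  then show "card (S \<inter> community c n i) = a n i" using fT[OF i] by simp
qed

context sbm
begin

lemma edge_model: "n \<ge> k \<Longrightarrow> edge_model n r (\<lambda>u v. q n (c n u) (c n v))"
  using r labels q_sym q_prob by unfold_locales (force intro: less_imp_le)+

lemma community_in_range: "i \<in> {1..k} \<Longrightarrow> community c n i \<subseteq> {..<n}"
  by (auto simp: community_def)

lemma sum_community:
  assumes n: "n \<ge> k" and F: "F \<subseteq> {..<n}"
  shows "(\<Sum>u\<in>F. f (c n u)) = (\<Sum>j\<in>{1..k}. f j * real (card (F \<inter> community c n j)))"
proof -
  have fin: "finite F" using F finite_subset by blast
  have "(\<Sum>u\<in>F. f (c n u)) = (\<Sum>j\<in>{1..k}. \<Sum>u\<in>{u \<in> F. c n u = j}. f (c n u))"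
    by (rule sum.group[symmetric]) (use fin F labels[OF n] in auto)
  also have "\<dots> = (\<Sum>j\<in>{1..k}. f j * real (card (F \<inter> community c n j)))"
  proof (rule sum.cong[OF refl])
    fix j
    have "{u \<in> F. c n u = j} = F \<inter> community c n j" using F by (auto simp: community_def)
    moreover have "(\<Sum>u\<in>{u \<in> F. c n u = j}. f (c n u)) = (\<Sum>u\<in>{u \<in> F. c n u = j}. f j)"
      by (rule sum.cong) auto
    ultimately show "(\<Sum>u\<in>{u \<in> F. c n u = j}. f (c n u)) = f j * real (card (F \<inter> community c n j))"
      by simp
  qed
  finally show ?thesis .
qed

text \<open>\<open>\<sigma>\<close> is the expected number of neighbours in \<open>F\<close>, the
  same for all nodes of community \<open>i\<close> outside \<open>F\<close>. Since
  \<open>q_le\<close> bounds every edge probability by \<open>q n i i\<close>, that value serves as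
  \<open>m\<close> in \<open>resist_le_poly\<close>. The two lower bounds are meant for
  \<open>\<sigma>\<close> near 0 and for bounded \<open>\<sigma>\<close>.\<close>

lemma resist_bounds:
  assumes n: "n \<ge> k" and F: "F \<subseteq> {..<n}" and i: "i \<in> {1..k}" and v: "v \<in> community c n i - F"
  defines "\<sigma> \<equiv> \<Sum>j\<in>{1..k}. q n i j * real (card (F \<inter> community c n j))"
    and "Q \<equiv> edge_model.resist n r (\<lambda>u v. q n (c n u) (c n v)) v F"
  shows "Q \<le> 2 ^ r * exp (- \<sigma> / 2)"
    and "(1 - \<sigma>) * max 0 (\<sigma> - r * q n i i) ^ r / fact r \<le> 1 - Q"
    and "q n i i \<le> 1 / 2 \<Longrightarrow> exp (- 2 * \<sigma>) * max 0 (\<sigma> - r * q n i i) ^ r / fact r \<le> 1 - Q"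
proof -
  interpret edge_model n r "\<lambda>u v. q n (c n u) (c n v)" using n by (rule edge_model)
  have v': "v < n" "v \<notin> F" "c n v = i" using v by (auto simp: community_def)
  have fin: "finite F" using F finite_subset by blast
  have \<sigma>: "(\<Sum>u\<in>F. q n (c n u) (c n v)) = \<sigma>"
    unfolding v'(3) sum_community[OF n F, of "\<lambda>j. q n j i"] \<sigma>_def using q_sym[OF n _ i] by simp
  have cu: "c n u \<in> {1..k}" if "u \<in> F" for u using labels[OF n] F that by auto
  have w: "q n (c n u) (c n v) \<in> {0..1}" "q n (c n u) (c n v) \<le> q n i i" if "u \<in> F" for u
    using q_prob[OF n cu[OF that] i] q_le[OF n cu[OF that] i] v'(3) by auto
  have p: "0 \<le> q n i i" using q_prob[OF n i i] by simp
  show "Q \<le> 2 ^ r * exp (- \<sigma> / 2)"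
    unfolding Q_def using resist_le_exp[OF v'(1,2) F] \<sigma> by simp
  have poly: "(\<Prod>u\<in>F. 1 - q n (c n u) (c n v)) * max 0 (\<sigma> - r * q n i i) ^ r / fact r \<le> 1 - Q"
    unfolding Q_def \<sigma>[symmetric] by (rule resist_le_poly[OF v'(1,2) F p w(2)])
  have lower: "e * max 0 (\<sigma> - r * q n i i) ^ r / fact r \<le> 1 - Q"
    if "e \<le> (\<Prod>u\<in>F. 1 - q n (c n u) (c n v))" for e
    by (rule order_trans[OF _ poly]) (intro divide_right_mono mult_right_mono that; simp)
  show "(1 - \<sigma>) * max 0 (\<sigma> - r * q n i i) ^ r / fact r \<le> 1 - Q"
    using prod_one_minus_ge[OF fin, of "\<lambda>u. q n (c n u) (c n v)"] w(1) \<sigma> by (intro lower) simp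
  show "exp (- 2 * \<sigma>) * max 0 (\<sigma> - r * q n i i) ^ r / fact r \<le> 1 - Q" if "q n i i \<le> 1 / 2"
  proof (rule lower)
    have "q n (c n u) (c n v) \<in> {0..1 / 2}" if "u \<in> F" for u
      using w[OF that] \<open>q n i i \<le> 1 / 2\<close> by auto
    from prod_one_minus_ge_exp[of F "\<lambda>u. q n (c n u) (c n v)", OF this]
    show "exp (- 2 * \<sigma>) \<le> (\<Prod>u\<in>F. 1 - q n (c n u) (c n v))" using \<sigma> by simp
  qed
qed

section \<open>Every small set has a community with an exponentially small quotient\<close>

lemma crit_size_dominates_first_uniformly:
  obtains l where "0 < l" "eventually (\<lambda>n. \<forall>i\<in>{1..k}. l * g n 1 \<le> g n i) sequentially"
proof -
  have "\<forall>i\<in>{1..k}. \<exists>l>0. eventually (\<lambda>n. l * g n 1 \<le> g n i) sequentially"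
    by (metis crit_size_dominates_first)
  then obtain l where l: "\<And>i. i \<in> {1..k} \<Longrightarrow> 0 < l i"
    "\<And>i. i \<in> {1..k} \<Longrightarrow> eventually (\<lambda>n. l i * g n 1 \<le> g n i) sequentially"
    by metis
  let ?l = "Min (l ` {1..k})"
  have 1: "1 \<in> {1..k}" using k by simp
  have "eventually (\<lambda>n. \<forall>i\<in>{1..k}. l i * g n 1 \<le> g n i) sequentially"
    by (intro eventually_ball_finite ballI l(2)) auto
  then have "eventually (\<lambda>n. \<forall>i\<in>{1..k}. ?l * g n 1 \<le> g n i) sequentially"
    using eventually_crit_size_pos[OF 1]
  proof eventually_elim
    case (elim n)
    show ?case
    proof
      fix i assume i: "i \<in> {1..k}"
      have "?l * g n 1 \<le> l i * g n 1" using i elim(2) by (intro mult_right_mono Min_le) auto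
      then show "?l * g n 1 \<le> g n i" using elim(1) i by fastforce
    qed
  qed
  moreover have "0 < ?l" using l(1) 1 by (subst Min_gr_iff) auto
  ultimately show ?thesis using that by blast
qed

text \<open>The three estimates are combined by cases on \<open>F\<close>. Two retention
  probabilities suffice, 1/2 away from the critical size and a fixed \<open>\<theta>\<close> close
  to 1 at the critical size; neither they nor \<open>C\<close> depend on \<open>n\<close> or
  \<open>F\<close>.\<close>

lemma eventually_thinning_gain:
  fixes a :: "nat \<Rightarrow> nat \<Rightarrow> nat" and \<alpha> :: "nat \<Rightarrow> real" and \<epsilon> :: real
  assumes seed_lim: "\<And>i. i \<in> {1..k} \<Longrightarrow> (\<lambda>n. real (a n i) / g n i) \<longlonglongrightarrow> \<alpha> i"
    and \<alpha>_nonneg: "\<And>i. i \<in> {1..k} \<Longrightarrow> \<alpha> i \<ge> 0"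
    and irred: "irreducible_matrix k chi_mat"
    and super: "min_rho r k chi_mat \<alpha> > 0"
    and \<epsilon>: "0 < \<epsilon>" "\<epsilon> \<le> 1 / 2"
  obtains \<theta> C where "0 < \<theta>" "\<theta> < 1" "0 < C"
    "eventually (\<lambda>n. \<forall>S F. S \<subseteq> F \<longrightarrow> F \<subseteq> {..<n} \<longrightarrow>
       (\<forall>i\<in>{1..k}. card (S \<inter> community c n i) = a n i) \<longrightarrow> real (card F) < (1 - \<epsilon>) * n \<longrightarrow>
       (\<exists>i\<in>{1..k}. \<exists>t\<in>{1 / 2, \<theta>}. edge_model.thinning_gain n r (\<lambda>u v. q n (c n u) (c n v))
          (community c n i - S) t (exp (- C * g n 1)) F)) sequentially"
proof -
  obtain K where K: "1 \<le> K" and mid: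
    "\<And>i. i \<in> {1..k} \<Longrightarrow> eventually (\<lambda>n. \<forall>\<sigma> Q s. K * g n i \<le> s \<longrightarrow> 16 * s \<le> N n i \<longrightarrow> q n i i * s \<le> \<sigma> \<longrightarrow>
       Q \<le> 2 ^ r * exp (- \<sigma> / 2) \<longrightarrow>
       exp (- 2 * \<sigma>) * max 0 (\<sigma> - r * q n i i) ^ r / fact r \<le> 1 - Q \<longrightarrow>
       8 * s \<le> (1 - Q) * N n i) sequentially"
    using intermediate_estimate by blast
  obtain \<delta> where \<delta>: "0 < \<delta>" and drift:
    "\<And>x. (\<And>i. i \<in> {1..k} \<Longrightarrow> x i \<in> {0..K}) \<Longrightarrow> \<exists>i\<in>{1..k}. \<delta> \<le> rho r k chi_mat \<alpha> i x"
    using rho_uniformly_pos_of_min_rho_pos[OF r k chi_nonneg chi_diag \<alpha>_nonneg super, of K] K by auto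
  obtain l where l: "0 < l" and first: "eventually (\<lambda>n. \<forall>i\<in>{1..k}. l * g n 1 \<le> g n i) sequentially"
    by (rule crit_size_dominates_first_uniformly)
  \<comment> \<open>The deletion probability in the critical case. \<open>d \<le> 1 / 2\<close>
    serves the logarithm bound, and \<open>8 * K * d \<le> \<delta>\<close> makes the second-order
    cost \<open>2 * d\<^sup>2 * m\<close> at most \<open>d * \<delta> / 4 * g n i\<close> when
    \<open>m \<le> K * g n i\<close>.\<close>
  define d where "d = min (1 / 2) (\<delta> / (8 * K))"
  have d: "0 < d" "d \<le> 1 / 2" "8 * K * d \<le> \<delta>"
    using \<delta> K by (auto simp: d_def min_def field_simps)
  \<comment> \<open>The smaller of the rates obtained: 1 in the saturated and intermediate cases,
    \<open>d * \<delta> / 4\<close> in the critical case.\<close>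
  define \<kappa> where "\<kappa> = min 1 (d * \<delta> / 4)"
  have \<kappa>: "0 < \<kappa>" "\<kappa> \<le> 1" "\<kappa> \<le> d * \<delta> / 4" using d \<delta> by (auto simp: \<kappa>_def)
  have sat: "eventually (\<lambda>n. \<forall>i\<in>{1..k}. \<forall>j\<in>{1..k}. chi_mat i j \<noteq> 0 \<longrightarrow>
      (\<forall>\<sigma> m l. q n i j * (N n j / 16) \<le> \<sigma> \<longrightarrow> real m \<le> N n i \<longrightarrow> \<epsilon> * N n i \<le> real l \<longrightarrow>
        (2 * (2 ^ r * exp (- \<sigma> / 2))) ^ l \<le> exp (- g n i) * (1 / 2) ^ m)) sequentially"
  proof (intro eventually_ball_finite ballI finite_atLeastAtMost)
    fix i j assume "i \<in> {1..k}" "j \<in> {1..k}"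
    then show "eventually (\<lambda>n. chi_mat i j \<noteq> 0 \<longrightarrow>
      (\<forall>\<sigma> m l. q n i j * (N n j / 16) \<le> \<sigma> \<longrightarrow> real m \<le> N n i \<longrightarrow> \<epsilon> * N n i \<le> real l \<longrightarrow>
        (2 * (2 ^ r * exp (- \<sigma> / 2))) ^ l \<le> exp (- g n i) * (1 / 2) ^ m)) sequentially"
      using saturated_estimate[of i j \<epsilon>] \<epsilon> by (cases "chi_mat i j = 0") auto
  qed
  have mid': "eventually (\<lambda>n. \<forall>i\<in>{1..k}. \<forall>\<sigma> Q s. K * g n i \<le> s \<longrightarrow> 16 * s \<le> N n i \<longrightarrow> q n i i * s \<le> \<sigma> \<longrightarrow>
       Q \<le> 2 ^ r * exp (- \<sigma> / 2) \<longrightarrow>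
       exp (- 2 * \<sigma>) * max 0 (\<sigma> - r * q n i i) ^ r / fact r \<le> 1 - Q \<longrightarrow>
       8 * s \<le> (1 - Q) * N n i) sequentially"
    by (intro eventually_ball_finite ballI mid finite_atLeastAtMost)
  have crit: "eventually (\<lambda>n. \<forall>i\<in>{1..k}. \<forall>s Q. (\<forall>j\<in>{1..k}. 0 \<le> s j \<and> s j \<le> K * g n j) \<longrightarrow>
     (1 - (\<Sum>j\<in>{1..k}. q n i j * s j)) * max 0 ((\<Sum>j\<in>{1..k}. q n i j * s j) - r * q n i i) ^ r / fact r \<le> 1 - Q \<longrightarrow>
     g n i * (rho_coeff * (\<Sum>j\<in>{1..k}. chi_mat i j * (s j / g n j)) ^ r - \<delta> / 4) \<le> (1 - Q) * (N n i - s i)) sequentially"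
    using K \<delta> by (intro eventually_ball_finite ballI critical_estimate finite_atLeastAtMost) auto
  have p_half: "eventually (\<lambda>n. \<forall>i\<in>{1..k}. q n i i < 1 / 2) sequentially"
    by (intro eventually_ball_finite ballI finite_atLeastAtMost order_tendstoD(2)[OF p_tendsto_0]) auto
  have seed: "eventually (\<lambda>n. \<forall>i\<in>{1..k}. \<alpha> i - \<delta> / 4 < a n i / g n i) sequentially"
    using \<delta> by (intro eventually_ball_finite ballI finite_atLeastAtMost order_tendstoD(1)[OF seed_lim]) auto
  have g_pos: "eventually (\<lambda>n. \<forall>i\<in>{1..k}. 0 < g n i) sequentially"
    by (intro eventually_ball_finite ballI finite_atLeastAtMost eventually_crit_size_pos)
  have "eventually (\<lambda>n. \<forall>S F. S \<subseteq> F \<longrightarrow> F \<subseteq> {..<n} \<longrightarrow>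
       (\<forall>i\<in>{1..k}. card (S \<inter> community c n i) = a n i) \<longrightarrow> real (card F) < (1 - \<epsilon>) * n \<longrightarrow>
       (\<exists>i\<in>{1..k}. \<exists>t\<in>{1 / 2, 1 - d}. edge_model.thinning_gain n r (\<lambda>u v. q n (c n u) (c n v))
          (community c n i - S) t (exp (- (\<kappa> * l) * g n 1)) F)) sequentially"
    using sat mid' crit p_half seed g_pos first eventually_ge_k
  proof eventually_elim
    case (elim n)
    note sat = elim(1) and mid = elim(2) and crit = elim(3) and p_half = elim(4) and seed = elim(5)
      and g_pos = elim(6) and first = elim(7) and n = elim(8)
    interpret edge_model n r "\<lambda>u v. q n (c n u) (c n v)" using n by (rule edge_model)
    let ?B = "exp (- (\<kappa> * l) * g n 1)"
    show ?case
    proof (intro allI impI)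
      fix S F assume SF: "S \<subseteq> F" and F: "F \<subseteq> {..<n}"
        and S: "\<forall>i\<in>{1..k}. card (S \<inter> community c n i) = a n i" and small: "real (card F) < (1 - \<epsilon>) * n"
      let ?goal = "\<exists>i\<in>{1..k}. \<exists>t\<in>{1 / 2, 1 - d}. thinning_gain (community c n i - S) t ?B F"
      define s where "s i = card (F \<inter> community c n i)" for i
      define \<sigma> where "\<sigma> i = (\<Sum>j\<in>{1..k}. q n i j * real (s j))" for i
      have fin: "finite F" "finite (community c n i)" for i
        using F finite_subset[of _ "{..<n}"] by (auto simp: community_def)
      have s_le: "s i \<le> comm_size c n i" for i
        unfolding s_def comm_size_def by (intro card_mono fin) auto
      have N: "0 < N n i" if "i \<in> {1..k}" for i using size_pos[OF n that] by simp
      have a_le: "a n i \<le> s i" if "i \<in> {1..k}" for i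
        using S that SF fin unfolding s_def by (metis Int_mono card_mono finite_Int order_refl)
      have card_in: "card ((community c n i - S) \<inter> F) = s i - a n i" if "i \<in> {1..k}" for i
      proof -
        have "(community c n i - S) \<inter> F = F \<inter> community c n i - S \<inter> community c n i" by auto
        then show ?thesis
          using S that SF fin unfolding s_def by (simp only:) (subst card_Diff_subset; auto)
      qed
      have card_out: "card (community c n i - S - F) = comm_size c n i - s i" for i
      proof -
        have "community c n i - S - F = community c n i - F \<inter> community c n i" using SF by auto
        then show ?thesis
          using fin unfolding s_def comm_size_def by (simp only:) (subst card_Diff_subset; auto)
      qed
      have resist: "resist v F \<le> 2 ^ r * exp (- \<sigma> i / 2)"
        "(1 - \<sigma> i) * max 0 (\<sigma> i - r * q n i i) ^ r / fact r \<le> 1 - resist v F"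
        "exp (- 2 * \<sigma> i) * max 0 (\<sigma> i - r * q n i i) ^ r / fact r \<le> 1 - resist v F"
        if i: "i \<in> {1..k}" and v: "v \<in> community c n i - S - F" for i v
      proof -
        have v': "v \<in> community c n i - F" using v by auto
        have "q n i i \<le> 1 / 2" using p_half i by force
        then show "resist v F \<le> 2 ^ r * exp (- \<sigma> i / 2)"
          "(1 - \<sigma> i) * max 0 (\<sigma> i - r * q n i i) ^ r / fact r \<le> 1 - resist v F"
          "exp (- 2 * \<sigma> i) * max 0 (\<sigma> i - r * q n i i) ^ r / fact r \<le> 1 - resist v F"
          using resist_bounds[OF n F i v'] unfolding s_def \<sigma>_def by auto
      qed
      have \<sigma>_ge: "q n i j * s j \<le> \<sigma> i" if "i \<in> {1..k}" "j \<in> {1..k}" for i j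
        unfolding \<sigma>_def using q_prob[OF n that(1)] that(2) by (intro member_le_sum) force+
      have B_ge: "exp (- (x * g n i)) \<le> ?B" if "i \<in> {1..k}" "\<kappa> \<le> x" for i x
      proof -
        have "\<kappa> * (l * g n 1) \<le> x * g n i"
          using that first g_pos \<kappa> l k by (intro mult_mono) (auto intro: less_imp_le order_trans)
        then show ?thesis by (simp add: mult_ac)
      qed
      have saturated: ?goal
        if i: "i \<in> {1..k}" and j: "j \<in> {1..k}" and "chi_mat i j \<noteq> 0" and sj: "N n j \<le> 16 * real (s j)"
          and si: "real (s i) < (1 - \<epsilon>) * N n i" for i j
      proof -
        have "q n i j * (N n j / 16) \<le> q n i j * s j"
          using sj q_prob[OF n i j] by (intro mult_left_mono) auto
        then have 1: "q n i j * (N n j / 16) \<le> \<sigma> i" using \<sigma>_ge[OF i j] by linarith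
        have 2: "real (s i - a n i) \<le> N n i" using s_le[of i] by simp
        have 3: "\<epsilon> * N n i \<le> real (comm_size c n i - s i)"
          using si s_le[of i] by (simp add: of_nat_diff algebra_simps)
        have "(2 * (2 ^ r * exp (- \<sigma> i / 2))) ^ (comm_size c n i - s i) \<le> exp (- g n i) * (1 / 2) ^ (s i - a n i)"
          using sat i j \<open>chi_mat i j \<noteq> 0\<close> 1 2 3 by blast
        then have "thinning_gain (community c n i - S) (1 / 2) (exp (- g n i)) F"
          by (intro thinning_gainI_half[where \<eta> = "2 ^ r * exp (- \<sigma> i / 2)"] resist(1)[OF i])
            (auto simp: card_in[OF i] card_out)
        then have "thinning_gain (community c n i - S) (1 / 2) ?B F"
          using B_ge[OF i, of 1] \<kappa>(2) by (auto intro: thinning_gain_mono)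
        then show ?thesis using i by blast
      qed
      show ?goal
      proof (cases "\<exists>i\<in>{1..k}. \<exists>j\<in>{1..k}. chi_mat i j \<noteq> 0 \<and> N n j \<le> 16 * real (s j) \<and> real (s i) < (1 - \<epsilon>) * N n i")
        case True
        then show ?thesis using saturated by blast
      next
        case False
        have sparse: "chi_mat i j = 0"
          if "i \<in> {1..k}" "j \<in> {1..k}" "N n j \<le> 16 * real (s j)" "real (s i) < (1 - \<epsilon>) * N n i" for i j
        proof (rule ccontr)
          assume "chi_mat i j \<noteq> 0"
          with that have "\<exists>i\<in>{1..k}. \<exists>j\<in>{1..k}. chi_mat i j \<noteq> 0 \<and> N n j \<le> 16 * real (s j) \<and> real (s i) < (1 - \<epsilon>) * N n i"
            by (intro bexI[of _ i] bexI[of _ j] conjI)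
          with False show False ..
        qed
        \<comment> \<open>The communities not nearly filled by \<open>F\<close>; some exist because
          \<open>F\<close> is small. A community outside \<open>?L\<close> is more than 1/16 full,
          so the failed saturated case makes \<open>chi\<close> vanish from \<open>?L\<close> to its
          complement, and irreducibility gives \<open>?L = {1..k}\<close>.\<close>
        let ?L = "{i \<in> {1..k}. real (s i) < (1 - \<epsilon>) * N n i}"
        have "?L \<noteq> {}"
        proof
          assume "?L = {}"
          then have "(1 - \<epsilon>) * N n j \<le> s j" if "j \<in> {1..k}" for j using that by force
          then have "(\<Sum>j\<in>{1..k}. (1 - \<epsilon>) * N n j) \<le> (\<Sum>j\<in>{1..k}. real (s j))" by (rule sum_mono)
          moreover have "(\<Sum>j\<in>{1..k}. real (s j)) = card F"
            using sum_community[OF n F, of "\<lambda>_. 1"] by (simp add: s_def)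
          moreover have "(\<Sum>j\<in>{1..k}. N n j) = n"
          proof -
            have "{..<n} \<inter> community c n j = community c n j" for j by (auto simp: community_def)
            then show ?thesis using sum_community[OF n order_refl, of "\<lambda>_. 1"] by (simp add: comm_size_def)
          qed
          ultimately show False using small by (simp flip: sum_distrib_left)
        qed
        moreover have "chi_mat i j = 0" if i: "i \<in> ?L" and j: "j \<in> {1..k} - ?L" for i j
        proof -
          have "(1 - \<epsilon>) * N n j \<le> s j" using j by auto
          moreover have "1 / 2 * N n j \<le> (1 - \<epsilon>) * N n j" using \<epsilon> by (intro mult_right_mono) auto
          ultimately have "N n j \<le> 16 * real (s j)" by linarith
          then show ?thesis using i j by (intro sparse) simp_all
        qed
        moreover have "?L \<subset> {1..k} \<or> ?L = {1..k}" by blast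
        ultimately have L: "?L = {1..k}"
          using irred unfolding irreducible_matrix_def by (metis (no_types, lifting))
        \<comment> \<open>The failed saturated case applied with \<open>j = i\<close>, where the
          matrix entry is 1.\<close>
        have s16: "16 * real (s i) \<le> N n i" if i: "i \<in> {1..k}" for i
        proof (rule ccontr)
          assume "\<not> ?thesis"
          moreover have "i \<in> ?L" using L i by simp
          ultimately have "chi_mat i i = 0" using i by (intro sparse) simp_all
          then show False using chi_diag[OF i] by simp
        qed
        show ?thesis
        proof (cases "\<exists>i\<in>{1..k}. K * g n i \<le> s i")
          case True
          then obtain i where i: "i \<in> {1..k}" and si: "K * g n i \<le> s i" by blast
          let ?U = "community c n i - S"
          have "0 < g n i" using g_pos i by blast
          then have gs: "g n i \<le> s i" using si mult_right_mono[OF K, of "g n i"] by linarith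
          have pi_le: "8 * real (s i) / N n i \<le> 1 - resist v F" if v: "v \<in> ?U - F" for v
          proof -
            have "8 * real (s i) \<le> (1 - resist v F) * N n i"
              using mid i si s16[OF i] \<sigma>_ge[OF i i] resist(1,3)[OF i v] by blast
            then show ?thesis using N[OF i] by (simp add: field_simps)
          qed
          \<comment> \<open>The exponent gained is at least \<open>7 / 2 * s i\<close>, enough for
            \<open>g n i \<le> s i\<close> and for at most \<open>s i\<close> factors 1/2.\<close>
          have gain_ge: "exp (- (1 - 1 / 2) * (8 * real (s i) / N n i) * card (?U - F)) \<le>
              exp (- g n i) * (1 / 2) ^ card (?U \<inter> F)"
          proof -
            have "15 / 16 * N n i \<le> real (comm_size c n i - s i)"
              using s16[OF i] s_le[of i] by (simp add: of_nat_diff)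
            then have ge: "8 * real (s i) / N n i * (15 / 16 * N n i) \<le>
                8 * real (s i) / N n i * real (comm_size c n i - s i)" by (intro mult_left_mono) auto
            have "7 * real (s i) \<le> 15 / 2 * real (s i)" by simp
            also have "\<dots> = 8 * real (s i) / N n i * (15 / 16 * N n i)" using N[OF i] by simp
            also note ge
            finally have seven: "7 * real (s i) \<le> 8 * real (s i) / N n i * real (comm_size c n i - s i)" .
            have half: "- (1 - 1 / 2) * z \<le> - g n i - y" if "7 * real (s i) \<le> z" "y \<le> real (s i)" for y z
              using that gs \<open>0 < g n i\<close> by simp
            have "- (1 - 1 / 2) * (8 * real (s i) / N n i * real (comm_size c n i - s i)) \<le>
                - g n i - real (s i - a n i)"
              by (rule half[OF seven]) simp
            then have "exp (- (1 - 1 / 2) * (8 * real (s i) / N n i) * card (?U - F)) \<le> exp (- g n i - real (s i - a n i))"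
              unfolding card_out exp_le_cancel_iff mult.assoc .
            also have "\<dots> = exp (- g n i) * (1 / exp 1) ^ (s i - a n i)"
              by (simp only: exp_diff power_divide exp_one_power power_one times_divide_eq_right mult_1_right)
            also have "\<dots> \<le> exp (- g n i) * (1 / 2) ^ (s i - a n i)"
              using exp_ge_add_one_self[of 1] by (intro mult_left_mono power_mono) (auto simp: field_simps)
            finally show ?thesis by (simp add: card_in[OF i])
          qed
          have "thinning_gain ?U (1 / 2) (exp (- g n i)) F"
            by (rule thinning_gainI_exp[OF _ _ pi_le gain_ge]) simp_all
          then have "thinning_gain ?U (1 / 2) ?B F"
            using B_ge[OF i, of 1] \<kappa>(2) by (auto intro: thinning_gain_mono)
          then show ?thesis using i by blast
        next
          case False
          \<comment> \<open>Now every community is below \<open>K\<close> times its critical size,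
            so the rescaled point lies in the cube and some coordinate has \<open>rho\<close> at
            least \<open>\<delta>\<close>.\<close>
          define x where "x j = real (s j) / g n j" for j
          have sK: "\<forall>j\<in>{1..k}. 0 \<le> real (s j) \<and> real (s j) \<le> K * g n j" using False by force
          then have "x j \<in> {0..K}" if "j \<in> {1..k}" for j
            using that g_pos by (auto simp: x_def field_simps)
          then obtain i where i: "i \<in> {1..k}" and \<rho>: "\<delta> \<le> rho r k chi_mat \<alpha> i x" using drift by blast
          let ?U = "community c n i - S" and ?m = "s i - a n i"
          define X where "X = rho_coeff * (\<Sum>j\<in>{1..k}. chi_mat i j * x j) ^ r"
          have \<rho>': "\<delta> \<le> \<alpha> i - x i + X" using \<rho> by (simp add: rho_def X_def rho_coeff_def)
          have gi: "0 < g n i" using g_pos i by blast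
          have pos: "0 < N n i - s i" using s16[OF i] N[OF i] by linarith
          let ?\<pi> = "g n i * (X - \<delta> / 4) / (N n i - s i)"
          have pi_le: "?\<pi> \<le> 1 - resist v F" if v: "v \<in> ?U - F" for v
          proof -
            have "g n i * (X - \<delta> / 4) \<le> (1 - resist v F) * (N n i - s i)"
              using bspec[OF crit i, rule_format, of "\<lambda>j. real (s j)" "resist v F"] sK resist(2)[OF i v]
              unfolding X_def x_def \<sigma>_def by blast
            then show ?thesis using pos by (simp add: field_simps)
          qed
          have gain_ge: "exp (- (1 - (1 - d)) * ?\<pi> * card (?U - F)) \<le> exp (- (d * \<delta> / 4 * g n i)) * (1 - d) ^ card (?U \<inter> F)"
          proof -
            have m: "real ?m = real (s i) - real (a n i)" using a_le[OF i] by (simp add: of_nat_diff)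
            have "\<alpha> i - \<delta> / 4 < a n i / g n i" using seed i by blast
            then have "g n i * (\<alpha> i - \<delta> / 4) \<le> a n i" using gi by (simp add: field_simps)
            moreover have "g n i * x i = real (s i)" using gi by (simp add: x_def)
            ultimately have m1: "real ?m \<le> g n i * (x i - \<alpha> i + \<delta> / 4)"
              unfolding m by (simp add: algebra_simps)
            have m2: "real ?m \<le> K * g n i" using bspec[OF sK i] m by linarith
            have "d * (d * (8 * real ?m)) \<le> d * (d * (8 * (K * g n i)))" using m2 d by (intro mult_left_mono) auto
            also have "\<dots> = d * ((8 * K * d) * g n i)" by simp
            also have "\<dots> \<le> d * (\<delta> * g n i)" using d gi by (intro mult_left_mono mult_right_mono) auto
            finally have quad: "2 * d\<^sup>2 * ?m \<le> d * \<delta> / 4 * g n i" by (simp add: power2_eq_square)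
            have "d * ?m \<le> d * (g n i * (x i - \<alpha> i + \<delta> / 4))" using m1 d by (intro mult_left_mono) auto
            moreover have "d * (g n i * (x i - \<alpha> i + \<delta>)) \<le> d * (g n i * X)"
              using \<rho>' d gi by (intro mult_left_mono) auto
            \<comment> \<open>Of the drift \<open>\<delta>\<close>, one quarter is lost in
              \<open>critical_estimate\<close>, one in replacing \<open>a n i\<close> by its limit
              and one in the second-order term; the last quarter is the rate.\<close>
            ultimately have total: "d * ?m + 2 * d\<^sup>2 * ?m + d * \<delta> / 4 * g n i \<le> d * (g n i * (X - \<delta> / 4))"
              using quad by (simp add: algebra_simps)
            have "?\<pi> * card (?U - F) = g n i * (X - \<delta> / 4)"
              using pos s_le[of i] by (simp add: card_out of_nat_diff)
            then have \<pi>: "- (1 - (1 - d)) * ?\<pi> * card (?U - F) = - (d * (g n i * (X - \<delta> / 4)))"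
              unfolding mult.assoc by simp
            \<comment> \<open>The price of retaining \<open>?m\<close> nodes with probability
              \<open>1 - d\<close> is at most \<open>d * ?m\<close> to first order plus
              \<open>2 * d\<^sup>2 * ?m\<close>.\<close>
            have "?m * (- d - 2 * d\<^sup>2) \<le> ?m * ln (1 - d)"
              using ln_one_minus_pos_lower_bound[of d] d by (intro mult_left_mono) auto
            then have "- (d * ?m + 2 * d\<^sup>2 * ?m) \<le> ?m * ln (1 - d)" by (simp add: algebra_simps)
            then have "- (1 - (1 - d)) * ?\<pi> * card (?U - F) \<le> - (d * \<delta> / 4 * g n i) + ?m * ln (1 - d)"
              unfolding \<pi> using total by simp
            then have "exp (- (1 - (1 - d)) * ?\<pi> * card (?U - F)) \<le> exp (- (d * \<delta> / 4 * g n i) + ?m * ln (1 - d))"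
              by (simp only: exp_le_cancel_iff)
            also have "\<dots> = exp (- (d * \<delta> / 4 * g n i)) * (1 - d) ^ ?m"
              using d by (subst exp_add, subst exp_of_nat_mult) simp
            finally show ?thesis by (simp only: card_in[OF i])
          qed
          have "thinning_gain ?U (1 - d) (exp (- (d * \<delta> / 4 * g n i))) F"
            by (rule thinning_gainI_exp[OF _ _ pi_le gain_ge]) (use d in simp_all)
          then have "thinning_gain ?U (1 - d) ?B F"
            by (rule thinning_gain_mono[OF _ B_ge[OF i \<kappa>(3)]]) (use d in simp_all)
          then show ?thesis using i by blast
        qed
      qed
    qed
  qed
  then show ?thesis
    using that[of "1 - d" "\<kappa> * l"] d \<kappa> l by simp
qed

end

theorem theorem3p3:
  fixes r k :: nat
    and c :: "nat \<Rightarrow> nat \<Rightarrow> nat"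
    and q :: "nat \<Rightarrow> nat \<Rightarrow> nat \<Rightarrow> real"
    and a :: "nat \<Rightarrow> nat \<Rightarrow> nat"
    and \<nu> \<gamma> \<mu> :: "nat \<Rightarrow> nat \<Rightarrow> real"
    and \<alpha> :: "nat \<Rightarrow> real"
  assumes r: "r \<ge> 2" and k: "k \<ge> 1"
    and labels: "\<And>n v. n \<ge> k \<Longrightarrow> v < n \<Longrightarrow> c n v \<in> {1..k}"
    and size_pos: "\<And>n i. n \<ge> k \<Longrightarrow> i \<in> {1..k} \<Longrightarrow> comm_size c n i \<ge> 1"
    and q_prob: "\<And>n i j. n \<ge> k \<Longrightarrow> i \<in> {1..k} \<Longrightarrow> j \<in> {1..k} \<Longrightarrow> q n i j \<in> {0..<1}"
    and q_sym: "\<And>n i j. n \<ge> k \<Longrightarrow> i \<in> {1..k} \<Longrightarrow> j \<in> {1..k} \<Longrightarrow> q n i j = q n j i"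
    and seed_le: "\<And>n i. n \<ge> k \<Longrightarrow> i \<in> {1..k} \<Longrightarrow> a n i \<le> comm_size c n i"
    and size_lim: "\<And>i j. i \<in> {1..k} \<Longrightarrow> j \<in> {1..k} \<Longrightarrow>
          (\<lambda>n. real (comm_size c n i) / real (comm_size c n j)) \<longlonglongrightarrow> \<nu> i j"
    and \<nu>_pos: "\<And>i j. i \<in> {1..k} \<Longrightarrow> j \<in> {1..k} \<Longrightarrow> \<nu> i j > 0"
    and p_lower: "\<And>i. i \<in> {1..k} \<Longrightarrow>
          (\<lambda>n. 1 / real (comm_size c n i)) \<in> o(\<lambda>n. q n i i)"
    and p_upper: "\<And>i. i \<in> {1..k} \<Longrightarrow>
          (\<lambda>n. q n i i) \<in> o(\<lambda>n. real (comm_size c n i) powr (- 1 / real r))"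
    and q_le: "\<And>n i j. n \<ge> k \<Longrightarrow> i \<in> {1..k} \<Longrightarrow> j \<in> {1..k} \<Longrightarrow>
          q n i j \<le> min (q n i i) (q n j j)"
    and q_lim: "\<And>i j. i \<in> {1..k} \<Longrightarrow> j \<in> {1..k} \<Longrightarrow> (\<lambda>n. q n i j / q n i i) \<longlonglongrightarrow> \<gamma> i j"
    and \<gamma>_range: "\<And>i j. i \<in> {1..k} \<Longrightarrow> j \<in> {1..k} \<Longrightarrow> \<gamma> i j \<in> {0..1}"
    and p_lim: "\<And>i j. i \<in> {1..k} \<Longrightarrow> j \<in> {1..k} \<Longrightarrow> (\<lambda>n. q n i i / q n j j) \<longlonglongrightarrow> \<mu> i j"
    and \<mu>_pos: "\<And>i j. i \<in> {1..k} \<Longrightarrow> j \<in> {1..k} \<Longrightarrow> \<mu> i j > 0"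
    and seed_lim: "\<And>i. i \<in> {1..k} \<Longrightarrow> (\<lambda>n. real (a n i) / crit_size r c q n i) \<longlonglongrightarrow> \<alpha> i"
    and \<alpha>_nonneg: "\<And>i. i \<in> {1..k} \<Longrightarrow> \<alpha> i \<ge> 0"
    and irred: "irreducible_matrix k (chi r c q)"
    and \<alpha>_decreasing: "\<And>i j. i \<in> {1..k} \<Longrightarrow> j \<in> {1..k} \<Longrightarrow> i \<le> j \<Longrightarrow> \<alpha> i \<ge> \<alpha> j"
    and \<alpha>_pos: "\<alpha> 1 > 0"
    and supercritical: "min_rho r k (chi r c q) \<alpha> > 0"
  shows "\<forall>\<epsilon>>0. \<exists>C>0.
           (\<lambda>n. measure_pmf.prob (final_active r k c q a n) {A. \<bar>real A / real n - 1\<bar> > \<epsilon>})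
             \<in> O(\<lambda>n. exp (- C * crit_size r c q n 1))"
proof (intro allI impI)
  interpret sbm r k c q \<nu> \<gamma> \<mu>
    by unfold_locales (fact r k labels size_pos q_prob q_sym size_lim \<nu>_pos p_lower p_upper q_le q_lim
        \<gamma>_range p_lim \<mu>_pos)+
  fix \<epsilon> :: real assume \<epsilon>: "\<epsilon> > 0"
  \<comment> \<open>Shrinking the tolerance only enlarges the bad event, and
    \<open>eventually_thinning_gain\<close> takes tolerances up to 1/2.\<close>
  define e where "e = min \<epsilon> (1 / 2)"
  have e: "0 < e" "e \<le> 1 / 2" "e \<le> \<epsilon>" using \<epsilon> by (auto simp: e_def)
  obtain \<theta> C where \<theta>: "0 < \<theta>" "\<theta> < 1" and C: "0 < C" and gain:
    "eventually (\<lambda>n. \<forall>S F. S \<subseteq> F \<longrightarrow> F \<subseteq> {..<n} \<longrightarrow>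
       (\<forall>i\<in>{1..k}. card (S \<inter> community c n i) = a n i) \<longrightarrow> real (card F) < (1 - e) * n \<longrightarrow>
       (\<exists>i\<in>{1..k}. \<exists>t\<in>{1 / 2, \<theta>}. edge_model.thinning_gain n r (\<lambda>u v. q n (c n u) (c n v))
          (community c n i - S) t (exp (- C * g n 1)) F)) sequentially"
    by (rule eventually_thinning_gain[OF seed_lim \<alpha>_nonneg irred supercritical e(1,2)])
  let ?T = "{1..k} \<times> {1 / 2, \<theta>}"
  have "eventually (\<lambda>n. measure_pmf.prob (final_active r k c q a n) {A. \<bar>real A / real n - 1\<bar> > \<epsilon>} \<le>
      real (card ?T) * exp (- C * g n 1)) sequentially"
    using gain eventually_ge_k
  proof eventually_elim
    case (elim n)
    note n = \<open>n \<ge> k\<close>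
    interpret edge_model n r "\<lambda>u v. q n (c n u) (c n v)" using n by (rule edge_model)
    let ?B = "exp (- C * g n 1)"
    let ?bad = "\<lambda>F. \<bar>real (card F) / real n - 1\<bar> > \<epsilon>"
    have "measure_pmf.prob (final_active r k c q a n) {A. \<bar>real A / real n - 1\<bar> > \<epsilon>} =
        measure_pmf.prob (pair_pmf (sbm_graph c q n) (seeds k c a n)) {(E, S). ?bad (bootstrap_final r E S)}"
      unfolding final_active_def by (simp add: vimage_def case_prod_unfold)
    also have "\<dots> \<le> real (card ?T) * ?B"
    proof (rule prob_pair_pmf_le)
      fix S assume "S \<in> set_pmf (seeds k c a n)"
      note S = seeds_support[OF seed_le[OF n] this]
      have "measure_pmf.prob (sbm_graph c q n) {E. ?bad (bootstrap_final r E S)} =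
          measure_pmf.prob edge_pmf {X. bootstrap_final r (graph X) S \<in> {F. ?bad F}}"
        unfolding sbm_graph_eq[where n = n and r = r and q = q and c = c, OF edge_model[OF n]] by (simp add: vimage_def)
      also have "\<dots> \<le> real (card ?T) * ?B"
      proof (rule prob_final_in_le_card[where U = "\<lambda>i. community c n i - S"])
        fix F assume F: "F \<in> {F. ?bad F}" "S \<subseteq> F" "F \<subseteq> {..<n}"
        \<comment> \<open>The final set never exceeds \<open>n\<close> nodes, so a deviation can
          only be a deficit.\<close>
        have "card F \<le> card {..<n}" by (rule card_mono[OF finite_lessThan F(3)])
        then have "card F \<le> n" by simp
        then have "real (card F) / n \<le> 1" by (cases "n = 0") auto
        then have "real (card F) / n < 1 - e" using F(1) e(3) by auto
        moreover have "n > 0" using n k by simp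
        ultimately have "real (card F) < (1 - e) * n" by (simp add: field_simps)
        then have "\<exists>i\<in>{1..k}. \<exists>t\<in>{1 / 2, \<theta>}. thinning_gain (community c n i - S) t ?B F"
          by (intro elim(1)[rule_format] F(2,3) S(2))
        then show "\<exists>(i, \<theta>)\<in>?T. thinning_gain (community c n i - S) \<theta> ?B F" by blast
      next
        show "community c n i - S \<subseteq> {..<n} - S \<and> 0 \<le> t \<and> t \<le> 1" if "(i, t) \<in> ?T" for i t
          using that \<theta> community_in_range[of i n] by auto
      qed (use S(1) in auto)
      finally show "measure_pmf.prob (sbm_graph c q n) {E. ?bad (bootstrap_final r E S)} \<le> real (card ?T) * ?B" .
    qed simp
    finally show ?case .
  qed
  then have "(\<lambda>n. measure_pmf.prob (final_active r k c q a n) {A. \<bar>real A / real n - 1\<bar> > \<epsilon>})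
      \<in> O(\<lambda>n. exp (- C * g n 1))"
    by (intro bigoI[of _ "real (card ?T)"]) (simp only: real_norm_def abs_exp_cancel abs_of_nonneg[OF measure_nonneg])
  then show "\<exists>C>0. (\<lambda>n. measure_pmf.prob (final_active r k c q a n) {A. \<bar>real A / real n - 1\<bar> > \<epsilon>})
      \<in> O(\<lambda>n. exp (- C * g n 1))"
    using C by blast
qed

end
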